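(* Let $\mathbf n=(n_1,\dots,n_k)\in\mathbb N^k$, $p\in\mathbb N$, let $\mathcal H$ be a Hilbert space and let $F:\mathbf B_{\mathbf n}(\mathcal H)\to B(\mathcal H)^p$ be a bounded free holomorphic function with $\|F\|_\infty\le1$. If $F(0)=0$, then $$\|F(\mathbf X)\|\le m_{\mathbf B_{\mathbf n}}(\mathbf X)<1\quad\text{and}\quad m_{\mathbf B_{\mathbf n}}(\mathbf X)\le\|\mathbf X\|,\qquad\mathbf X\in\mathbf B_{\mathbf n}(\mathcal H),$$ where $m_{\mathbf B_{\mathbf n}}$ is the Minkowski functional associated with $\mathbf B_{\mathbf n}(\mathcal H)$. In particular, if $p=1$, the free holomorphic function $$\psi(\mathbf X)=\sum_{i=1}^k\sum_{j=1}^{n_i}\frac{\partial F}{\partial Z_{i,j}}(0)\,X_{i,j},\qquad\mathbf X=(X_{i,j})\in\mathbf B_{\mathbf n}(\mathcal H),$$ has the property that $\|\psi(\mathbf X)\|\le m_{\mathbf B_{\mathbf n}}(\mathbf X)<1$.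
   Context: **Polyball.** For a complex Hilbert space $\mathcal H$, $B(\mathcal H)^{n_1}\times_c\cdots\times_c B(\mathcal H)^{n_k}$ is the set of tuples $\mathbf X=(X_1,\dots,X_k)$, $X_i=(X_{i,1},\dots,X_{i,n_i})\in B(\mathcal H)^{n_i}$, such that each entry of $X_s$ commutes with each entry of $X_t$ whenever $s\neq t$ (entries of a single $X_s$ need not commute). Put $\Phi_{X_i}(Y)=\sum_{j=1}^{n_i}X_{i,j}YX_{i,j}^*$ and $\mathbf\Delta_{\mathbf X}=(id-\Phi_{X_1})\circ\cdots\circ(id-\Phi_{X_k})$ on $B(\mathcal H)$. The regular polyball $\mathbf B_{\mathbf n}(\mathcal H)$ is the set of all such $\mathbf X$ with $\|\sum_jX_{i,j}X_{i,j}^*\|<1$ for each $i$ and $\mathbf\Delta_{\mathbf X}(I)>0$ (positive and invertible). Tuples of operators carry the row-operator norm; in particular $\|\mathbf X\|=\|\sum_{i,j}X_{i,j}X_{i,j}^*\|^{1/2}$ and $\|F(\mathbf X)\|=\|\sum_{s=1}^pF_s(\mathbf X)F_s(\mathbf X)^*\|^{1/2}$. **Minkowski functional.** $m_{\mathbf B_{\mathbf n}}(\mathbf X)=\inf\{r>0:\mathbf X\in r\mathbf B_{\mathbf n}(\mathcal H)\}$ for $\mathbf X\in B(\mathcal H)^{n_1}\times_c\cdots\times_c B(\mathcal H)^{n_k}$. **Free holomorphic functions.** $\mathbb F_{n_i}^+$ is the unital free semigroup on $g^i_1,\dots,g^i_{n_i}$, with word length $|\cdot|$. For $\alpha=g^i_{j_1}\cdots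 g^i_{j_p}$ put $X_{i,\alpha}=X_{i,j_1}\cdots X_{i,j_p}$ ($I$ for the empty word), and $X_{(\alpha)}=X_{1,\alpha_1}\cdots X_{k,\alpha_k}$ for $(\alpha)=(\alpha_1,\dots,\alpha_k)$. A free holomorphic function (scalar coefficients) on the abstract polyball $\mathbf B_{\mathbf n}=\{\mathbf B_{\mathbf n}(\mathcal H):\mathcal H\text{ a Hilbert space}\}$ is a formal series $\varphi=\sum_{(\alpha)}a_{(\alpha)}Z_{(\alpha)}$, $a_{(\alpha)}\in\mathbb C$, such that $\varphi(\mathbf X)=\sum_{(p_1,\dots,p_k)\in\mathbb Z_+^k}\sum_{|\alpha_i|=p_i}a_{(\alpha)}X_{(\alpha)}$ converges in operator norm for all $\mathbf X\in\mathbf B_{\mathbf n}(\mathcal H)$ and all $\mathcal H$. $F=(F_1,\dots,F_p)$ is free holomorphic if each $F_s$ is; $\|F\|_\infty=\sup\|F(\mathbf X)\|$ over all $\mathbf X\in\mathbf B_{\mathbf n}(\mathcal H)$ and all $\mathcal H$, and $F$ is bounded if this is finite. The free partial derivative $\partial/\partial Z_{i,j}$ is the linear derivation on formal power series in the $Z_{s,q}$ with $\partial I/\partial Z_{i,j}=0$, $\partial Z_{i,j}/\partial Z_{i,j}=I$, $\partial Z_{s,q}/\partial Z_{i,j}=0$ for $(s,q)\ne(i,j)$, and the Leibniz rule, applied termwise; thus $\frac{\partial F}{\partial Z_{i,j}}(0)$ is the coefficient of $Z_{i,j}$ in $F$. *)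

theory Defs
  imports "HOL-Analysis.Analysis" "HOL-Algebra.Module"
begin

section \<open>Complex Hilbert spaces\<close>

text \<open>Hilbert spaces are modules over the complex numbers in the sense of HOL-Algebra, with an
  explicit carrier, so that one can quantify over all Hilbert spaces (with carrier contained in a
  given type) inside a formula.  The fields \<open>mult\<close> and \<open>one\<close> inherited from the record of modules
  are not used.\<close>

definition complex_ring :: "complex ring" where
  "complex_ring = \<lparr>carrier = UNIV, monoid.mult = (*), one = 1, ring.zero = 0, add = (+)\<rparr>"

record 'a cinner_module = "(complex, 'a) module" +
  cinner :: "'a \<Rightarrow> 'a \<Rightarrow> complex"

definition vnorm :: "'a cinner_module \<Rightarrow> 'a \<Rightarrow> real" where
  "vnorm H x = sqrt (Re (cinner H x x))"

locale complex_hilbert_space = module complex_ring H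
  for H :: "'a cinner_module" +
  assumes cinner_add_left: "\<lbrakk>x \<in> carrier H; y \<in> carrier H; z \<in> carrier H\<rbrakk>
      \<Longrightarrow> cinner H (x \<oplus>\<^bsub>H\<^esub> y) z = cinner H x z + cinner H y z"
    and cinner_smult_left: "\<lbrakk>x \<in> carrier H; y \<in> carrier H\<rbrakk>
      \<Longrightarrow> cinner H (c \<odot>\<^bsub>H\<^esub> x) y = c * cinner H x y"
    and cinner_commute: "\<lbrakk>x \<in> carrier H; y \<in> carrier H\<rbrakk> \<Longrightarrow> cinner H x y = cnj (cinner H y x)"
    and cinner_pos: "\<lbrakk>x \<in> carrier H; x \<noteq> \<zero>\<^bsub>H\<^esub>\<rbrakk> \<Longrightarrow> 0 < Re (cinner H x x)"
    and complete: "\<lbrakk>\<And>m. u m \<in> carrier H;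
        \<And>e. e > 0 \<Longrightarrow> \<exists>N. \<forall>l\<ge>N. \<forall>m\<ge>N. vnorm H (u l \<ominus>\<^bsub>H\<^esub> u m) < e\<rbrakk>
      \<Longrightarrow> \<exists>x\<in>carrier H. (\<lambda>m. vnorm H (u m \<ominus>\<^bsub>H\<^esub> x)) \<longlonglongrightarrow> 0"

section \<open>Bounded operators\<close>

definition bounded_ops :: "'a cinner_module \<Rightarrow> ('a \<Rightarrow> 'a) set" where
  "bounded_ops H = {T \<in> carrier H \<rightarrow>\<^sub>E carrier H.
     (\<forall>x\<in>carrier H. \<forall>y\<in>carrier H. T (x \<oplus>\<^bsub>H\<^esub> y) = T x \<oplus>\<^bsub>H\<^esub> T y) \<and>
     (\<forall>c. \<forall>x\<in>carrier H. T (c \<odot>\<^bsub>H\<^esub> x) = c \<odot>\<^bsub>H\<^esub> T x) \<and>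
     (\<exists>C. \<forall>x\<in>carrier H. vnorm H (T x) \<le> C * vnorm H x)}"

definition op_norm :: "'a cinner_module \<Rightarrow> ('a \<Rightarrow> 'a) \<Rightarrow> real" where
  "op_norm H T = (SUP x\<in>{x \<in> carrier H. vnorm H x \<le> 1}. vnorm H (T x))"

definition op_zero :: "'a cinner_module \<Rightarrow> 'a \<Rightarrow> 'a" where
  "op_zero H = (\<lambda>x\<in>carrier H. \<zero>\<^bsub>H\<^esub>)"

definition op_id :: "'a cinner_module \<Rightarrow> 'a \<Rightarrow> 'a" where
  "op_id H = (\<lambda>x\<in>carrier H. x)"

definition op_diff :: "'a cinner_module \<Rightarrow> ('a \<Rightarrow> 'a) \<Rightarrow> ('a \<Rightarrow> 'a) \<Rightarrow> 'a \<Rightarrow> 'a" where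
  "op_diff H S T = (\<lambda>x\<in>carrier H. S x \<ominus>\<^bsub>H\<^esub> T x)"

definition op_scale :: "'a cinner_module \<Rightarrow> complex \<Rightarrow> ('a \<Rightarrow> 'a) \<Rightarrow> 'a \<Rightarrow> 'a" where
  "op_scale H c T = (\<lambda>x\<in>carrier H. c \<odot>\<^bsub>H\<^esub> T x)"

definition op_mult :: "'a cinner_module \<Rightarrow> ('a \<Rightarrow> 'a) \<Rightarrow> ('a \<Rightarrow> 'a) \<Rightarrow> 'a \<Rightarrow> 'a" where
  "op_mult H S T = compose (carrier H) S T"

definition op_prod :: "'a cinner_module \<Rightarrow> ('a \<Rightarrow> 'a) list \<Rightarrow> 'a \<Rightarrow> 'a" where
  "op_prod H Ts = foldr (op_mult H) Ts (op_id H)"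

definition op_sum :: "'a cinner_module \<Rightarrow> ('i \<Rightarrow> 'a \<Rightarrow> 'a) \<Rightarrow> 'i set \<Rightarrow> 'a \<Rightarrow> 'a" where
  "op_sum H f A = (\<lambda>x\<in>carrier H. \<Oplus>\<^bsub>H\<^esub>i\<in>A. f i x)"

definition adj :: "'a cinner_module \<Rightarrow> ('a \<Rightarrow> 'a) \<Rightarrow> 'a \<Rightarrow> 'a" where
  "adj H T = (\<lambda>y\<in>carrier H.
     THE z. z \<in> carrier H \<and> (\<forall>x\<in>carrier H. cinner H (T x) y = cinner H x z))"

definition positive_op :: "'a cinner_module \<Rightarrow> ('a \<Rightarrow> 'a) \<Rightarrow> bool" where
  "positive_op H T \<longleftrightarrow> T \<in> bounded_ops H \<and>
     (\<forall>x\<in>carrier H. Im (cinner H (T x) x) = 0 \<and> 0 \<le> Re (cinner H (T x) x))"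

definition invertible_op :: "'a cinner_module \<Rightarrow> ('a \<Rightarrow> 'a) \<Rightarrow> bool" where
  "invertible_op H T \<longleftrightarrow>
     (\<exists>S\<in>bounded_ops H. op_mult H S T = op_id H \<and> op_mult H T S = op_id H)"

definition row_norm :: "'a cinner_module \<Rightarrow> ('i \<Rightarrow> 'a \<Rightarrow> 'a) \<Rightarrow> 'i set \<Rightarrow> real" where
  "row_norm H f A = sqrt (op_norm H (op_sum H (\<lambda>i. op_mult H (f i) (adj H (f i))) A))"

text \<open>Unordered convergence in operator norm of a family of operators.\<close>

definition op_has_sum :: "'a cinner_module \<Rightarrow> ('i \<Rightarrow> 'a \<Rightarrow> 'a) \<Rightarrow> 'i set \<Rightarrow> ('a \<Rightarrow> 'a) \<Rightarrow> bool" where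
  "op_has_sum H f A T \<longleftrightarrow> T \<in> bounded_ops H \<and>
     ((\<lambda>B. op_norm H (op_diff H (op_sum H f B) T)) \<longlongrightarrow> 0) (finite_subsets_at_top A)"

section \<open>The regular polyball\<close>

text \<open>A tuple \<open>(X\<^sub>1, \<dots>, X\<^sub>k)\<close> with \<open>X\<^sub>i = (X\<^sub>i\<^sub>,\<^sub>1, \<dots>, X\<^sub>i\<^sub>,\<^sub>n\<^sub>i)\<close> is a function of two indices, both
  counted from 0: \<open>X i j\<close> is relevant for \<open>i < k\<close> and \<open>j < n i\<close> only.\<close>

type_synonym 'a op_tuple = "nat \<Rightarrow> nat \<Rightarrow> 'a \<Rightarrow> 'a"

definition commuting_tuples :: "'a cinner_module \<Rightarrow> nat \<Rightarrow> (nat \<Rightarrow> nat) \<Rightarrow> 'a op_tuple set" where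
  "commuting_tuples H k n = {X.
     (\<forall>i<k. \<forall>j<n i. X i j \<in> bounded_ops H) \<and>
     (\<forall>s<k. \<forall>t<k. s \<noteq> t \<longrightarrow>
        (\<forall>i<n s. \<forall>j<n t. op_mult H (X s i) (X t j) = op_mult H (X t j) (X s i)))}"

definition zero_tuple :: "'a cinner_module \<Rightarrow> 'a op_tuple" where
  "zero_tuple H = (\<lambda>i j. op_zero H)"

definition Phi :: "'a cinner_module \<Rightarrow> nat \<Rightarrow> (nat \<Rightarrow> 'a \<Rightarrow> 'a) \<Rightarrow> ('a \<Rightarrow> 'a) \<Rightarrow> 'a \<Rightarrow> 'a" where
  "Phi H m T Y = op_sum H (\<lambda>j. op_mult H (T j) (op_mult H Y (adj H (T j)))) {..<m}"

definition Defect :: "'a cinner_module \<Rightarrow> nat \<Rightarrow> (nat \<Rightarrow> nat) \<Rightarrow> 'a op_tuple \<Rightarrow> ('a \<Rightarrow> 'a) \<Rightarrow> 'a \<Rightarrow> 'a" where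
  "Defect H k n X = foldr (\<lambda>i Y. op_diff H Y (Phi H (n i) (X i) Y)) [0..<k]"

definition polyball :: "'a cinner_module \<Rightarrow> nat \<Rightarrow> (nat \<Rightarrow> nat) \<Rightarrow> 'a op_tuple set" where
  "polyball H k n = {X \<in> commuting_tuples H k n.
     (\<forall>i<k. op_norm H (op_sum H (\<lambda>j. op_mult H (X i j) (adj H (X i j))) {..<n i}) < 1) \<and>
     positive_op H (Defect H k n X (op_id H)) \<and> invertible_op H (Defect H k n X (op_id H))}"

definition tuple_norm :: "'a cinner_module \<Rightarrow> nat \<Rightarrow> (nat \<Rightarrow> nat) \<Rightarrow> 'a op_tuple \<Rightarrow> real" where
  "tuple_norm H k n X = row_norm H (\<lambda>(i, j). X i j) (SIGMA i:{..<k}. {..<n i})"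

definition minkowski :: "'a cinner_module \<Rightarrow> nat \<Rightarrow> (nat \<Rightarrow> nat) \<Rightarrow> 'a op_tuple \<Rightarrow> real" where
  "minkowski H k n X = Inf {r. r > 0 \<and>
     (\<exists>Y\<in>polyball H k n. \<forall>i<k. \<forall>j<n i. X i j = op_scale H (complex_of_real r) (Y i j))}"

section \<open>Free holomorphic functions\<close>

text \<open>A word in \<open>g\<^sub>1, \<dots>, g\<^sub>m\<close> is a list of indices below \<open>m\<close>, and a \<open>k\<close>-tuple of words is a list of
  words.  A formal series is given by its coefficients \<open>a \<alpha>\<close>, of which only those with
  \<open>\<alpha> \<in> multiwords k n\<close> are relevant.\<close>

type_synonym formal_series = "nat list list \<Rightarrow> complex"

definition multiwords :: "nat \<Rightarrow> (nat \<Rightarrow> nat) \<Rightarrow> nat list list set" where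
  "multiwords k n = {\<alpha>. length \<alpha> = k \<and> (\<forall>i<k. set (\<alpha> ! i) \<subseteq> {..<n i})}"

definition monomial_op :: "'a cinner_module \<Rightarrow> nat \<Rightarrow> 'a op_tuple \<Rightarrow> nat list list \<Rightarrow> 'a \<Rightarrow> 'a" where
  "monomial_op H k X \<alpha> = op_prod H (map (\<lambda>i. op_prod H (map (X i) (\<alpha> ! i))) [0..<k])"

definition homogeneous_part ::
  "'a cinner_module \<Rightarrow> nat \<Rightarrow> (nat \<Rightarrow> nat) \<Rightarrow> formal_series \<Rightarrow> 'a op_tuple \<Rightarrow> nat list \<Rightarrow> 'a \<Rightarrow> 'a" where
  "homogeneous_part H k n a X q =
     op_sum H (\<lambda>\<alpha>. op_scale H (a \<alpha>) (monomial_op H k X \<alpha>)) {\<alpha> \<in> multiwords k n. map length \<alpha> = q}"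

definition series_has_value ::
  "'a cinner_module \<Rightarrow> nat \<Rightarrow> (nat \<Rightarrow> nat) \<Rightarrow> formal_series \<Rightarrow> 'a op_tuple \<Rightarrow> ('a \<Rightarrow> 'a) \<Rightarrow> bool" where
  "series_has_value H k n a X T \<longleftrightarrow>
     op_has_sum H (homogeneous_part H k n a X) {q. length q = k} T"

definition series_value ::
  "'a cinner_module \<Rightarrow> nat \<Rightarrow> (nat \<Rightarrow> nat) \<Rightarrow> formal_series \<Rightarrow> 'a op_tuple \<Rightarrow> 'a \<Rightarrow> 'a" where
  "series_value H k n a X = (THE T. series_has_value H k n a X T)"

text \<open>``All Hilbert spaces'' are those with carrier contained in the type \<open>'a\<close>.  As soon as \<open>'a\<close>
  contains the carrier of one nonzero Hilbert space, it contains, up to isomorphism, all separable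
  ones.\<close>

definition free_holomorphic :: "'a itself \<Rightarrow> nat \<Rightarrow> (nat \<Rightarrow> nat) \<Rightarrow> formal_series \<Rightarrow> bool" where
  "free_holomorphic _ k n a \<longleftrightarrow>
     (\<forall>H :: 'a cinner_module. complex_hilbert_space H \<longrightarrow>
        (\<forall>X\<in>polyball H k n. \<exists>T. series_has_value H k n a X T))"

definition sup_norm :: "'a itself \<Rightarrow> nat \<Rightarrow> (nat \<Rightarrow> nat) \<Rightarrow> nat \<Rightarrow> (nat \<Rightarrow> formal_series) \<Rightarrow> ennreal" where
  "sup_norm _ k n p F =
     (SUP (H, X)\<in>{(H :: 'a cinner_module, X). complex_hilbert_space H \<and> X \<in> polyball H k n}.
        ennreal (row_norm H (\<lambda>s. series_value H k n (F s) X) {..<p}))"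

definition bounded_free_holomorphic ::
  "'a itself \<Rightarrow> nat \<Rightarrow> (nat \<Rightarrow> nat) \<Rightarrow> nat \<Rightarrow> (nat \<Rightarrow> formal_series) \<Rightarrow> bool" where
  "bounded_free_holomorphic A k n p F \<longleftrightarrow>
     (\<forall>s<p. free_holomorphic A k n (F s)) \<and> sup_norm A k n p F < \<infinity>"

section \<open>Free partial derivatives\<close>

text \<open>The terms (with repetition) of the derivative of a word with respect to its letter \<open>j\<close>; the
  second equation is the Leibniz rule for the product of a letter and a word.\<close>

primrec word_deriv :: "nat \<Rightarrow> nat list \<Rightarrow> nat list list" where
  "word_deriv j [] = []"
| "word_deriv j (l # w) = (if l = j then [w] else []) @ map ((#) l) (word_deriv j w)"

text \<open>Since the derivation with respect to \<open>Z\<^sub>i\<^sub>,\<^sub>j\<close> annihilates the words in the other blocks, the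
  Leibniz rule for \<open>Z\<^sub>1\<^sub>,\<^sub>\<alpha>\<^sub>1 \<cdots> Z\<^sub>k\<^sub>,\<^sub>\<alpha>\<^sub>k\<close> leaves only the derivative of the \<open>i\<close>-th factor.\<close>

definition monomial_deriv :: "nat \<Rightarrow> nat \<Rightarrow> nat list list \<Rightarrow> nat list list list" where
  "monomial_deriv i j \<alpha> = map (\<lambda>w. \<alpha>[i := w]) (word_deriv j (\<alpha> ! i))"

definition free_deriv :: "nat \<Rightarrow> (nat \<Rightarrow> nat) \<Rightarrow> nat \<Rightarrow> nat \<Rightarrow> formal_series \<Rightarrow> formal_series" where
  "free_deriv k n i j a = (\<lambda>\<beta>. \<Sum>\<alpha> | \<alpha> \<in> multiwords k n \<and> \<beta> \<in> set (monomial_deriv i j \<alpha>).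
     a \<alpha> * of_nat (count_list (monomial_deriv i j \<alpha>) \<beta>))"

text \<open>The scalar value of a series at 0.\<close>

definition const_coeff :: "nat \<Rightarrow> formal_series \<Rightarrow> complex" where
  "const_coeff k a = a (replicate k [])"

definition indeterminate :: "nat \<Rightarrow> nat \<Rightarrow> nat \<Rightarrow> formal_series" where
  "indeterminate k i j = (\<lambda>\<alpha>. if \<alpha> = (replicate k [])[i := [j]] then 1 else 0)"

definition linear_part :: "nat \<Rightarrow> (nat \<Rightarrow> nat) \<Rightarrow> formal_series \<Rightarrow> formal_series" where
  "linear_part k n a = (\<lambda>\<alpha>. \<Sum>i<k. \<Sum>j<n i.
     const_coeff k (free_deriv k n i j a) * indeterminate k i j \<alpha>)"

end

theory Submission
  imports Defs "HOL-Complex_Analysis.Conformal_Mappings"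
begin

text \<open>
  The statement is the Schwarz lemma on the complex lines through the origin.  If \<open>X = r Y\<close> with \<open>Y\<close>
  in the polyball and \<open>0 < r < 1\<close>, then all \<open>z Y\<close> with \<open>|z| < 1\<close> lie in the polyball, and for
  vectors \<open>x\<close> and \<open>y\<^sub>s\<close> the scalar function \<open>z \<mapsto> \<Sum>\<^sub>s \<langle>F\<^sub>s(z Y) y\<^sub>s, x\<rangle>\<close> is a power series on the unit
  disc that vanishes at 0 and is bounded by \<open>(\<Sum>\<^sub>s \<parallel>y\<^sub>s\<parallel>\<^sup>2)\<^sup>1\<^sup>/\<^sup>2 \<parallel>x\<parallel>\<close>.  The Schwarz lemma
  (\<open>graded_schwarz\<close>, \<open>schwarz_at_tuple\<close>) bounds its value at \<open>z = r\<close>, and the choice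
  \<open>y\<^sub>s = F\<^sub>s(X)\<^sup>* x\<close> turns this into \<open>\<Sum>\<^sub>s \<parallel>F\<^sub>s(X)\<^sup>* x\<parallel>\<^sup>2 \<le> r\<^sup>2 \<parallel>x\<parallel>\<^sup>2\<close>, that is
  \<open>\<parallel>F(X)\<parallel> \<le> r\<close>.  The infimum over \<open>r\<close> gives \<open>schwarz_minkowski\<close>.  The coefficient of \<open>z\<close> in the same
  power series is \<open>\<langle>\<psi>(Y) y, x\<rangle>\<close>; its bound makes \<open>\<psi>(Y)\<close> a contraction, and \<open>\<psi>(X) = r \<psi>(Y)\<close>.

  What remains is the geometry of the polyball: it contains \<open>z Y\<close> for \<open>|z| \<le> 1\<close>
  (\<open>polyball_balanced\<close>), it is open along rays (\<open>polyball_expand\<close>, whence \<open>m(X) < 1\<close>), and it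
  contains the open row ball (\<open>row_ball_subset_polyball\<close>, whence \<open>m(X) \<le> \<parallel>X\<parallel>\<close>).  Membership is a
  condition on quadratic forms: by \<open>polyball_iff\<close> the defect condition says that the form
  \<open>(id - \<Phi>\<^sub>1) \<dots> (id - \<Phi>\<^sub>k) \<parallel>\<cdot>\<parallel>\<^sup>2\<close> is bounded below by a positive multiple of \<open>\<parallel>\<cdot>\<parallel>\<^sup>2\<close>, where \<open>\<Phi>\<^sub>i\<close>
  acts on forms by \<open>(\<Phi>\<^sub>i q)(x) = \<Sum>\<^sub>j q(X\<^sub>i\<^sub>,\<^sub>j\<^sup>* x)\<close>.  The maps \<open>\<Phi>\<^sub>i\<close> are positive, commute with each
  other and are strict contractions on \<open>\<parallel>\<cdot>\<parallel>\<^sup>2\<close>, so \<open>q \<ge> \<Phi>\<^sub>i q\<close> forces \<open>q \<ge> 0\<close>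
  (\<open>inverse_positive\<close>).  Hence replacing one factor \<open>id - \<Phi>\<^sub>i\<close> after the other by \<open>id - t \<Phi>\<^sub>i\<close> with
  \<open>0 \<le> t \<le> 1\<close> preserves the lower bound (\<open>defect_form_shrink\<close>).

  Adjoints and inverses of coercive operators both come from one variational argument,
  \<open>coercive_representation\<close>, which contains the Riesz representation theorem.
\<close>

section \<open>Inner products\<close>

lemma complex_ring_simps [simp]:
  "carrier complex_ring = UNIV" "\<zero>\<^bsub>complex_ring\<^esub> = 0" "\<one>\<^bsub>complex_ring\<^esub> = 1"
  "a \<oplus>\<^bsub>complex_ring\<^esub> b = a + b" "a \<otimes>\<^bsub>complex_ring\<^esub> b = a * b"
  by (simp_all add: complex_ring_def)

context complex_hilbert_space
begin

abbreviation V :: "'a set" where "V \<equiv> carrier H"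
abbreviation ip :: "'a \<Rightarrow> 'a \<Rightarrow> complex" where "ip \<equiv> cinner H"
abbreviation nrm :: "'a \<Rightarrow> real" where "nrm \<equiv> vnorm H"

lemma minus_eq_smult: "x \<in> V \<Longrightarrow> \<ominus>\<^bsub>H\<^esub> x = (- 1) \<odot>\<^bsub>H\<^esub> x"
proof -
  assume x: "x \<in> V"
  have "x \<oplus>\<^bsub>H\<^esub> (- 1) \<odot>\<^bsub>H\<^esub> x = (1 + - 1) \<odot>\<^bsub>H\<^esub> x"
    using smult_l_distr[of 1 "-1" x] smult_one[of x] x by simp
  also have "\<dots> = \<zero>\<^bsub>H\<^esub>" using smult_l_null[of x] x by simp
  finally show ?thesis
    using x M.minus_equality[of "(- 1) \<odot>\<^bsub>H\<^esub> x" x] by (simp add: M.a_comm)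
qed

lemma smult_in [simp]: "x \<in> V \<Longrightarrow> c \<odot>\<^bsub>H\<^esub> x \<in> V"
  by (rule smult_closed) auto

lemma diff_eq: "x \<in> V \<Longrightarrow> y \<in> V \<Longrightarrow> x \<ominus>\<^bsub>H\<^esub> y = x \<oplus>\<^bsub>H\<^esub> (- 1) \<odot>\<^bsub>H\<^esub> y"
  by (simp add: a_minus_def minus_eq_smult)

lemma diff_in [simp]: "x \<in> V \<Longrightarrow> y \<in> V \<Longrightarrow> x \<ominus>\<^bsub>H\<^esub> y \<in> V"
  by (simp add: diff_eq)

lemma ip_add_left: "x \<in> V \<Longrightarrow> y \<in> V \<Longrightarrow> z \<in> V \<Longrightarrow> ip (x \<oplus>\<^bsub>H\<^esub> y) z = ip x z + ip y z"
  by (rule cinner_add_left)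

lemma ip_add_right: "x \<in> V \<Longrightarrow> y \<in> V \<Longrightarrow> z \<in> V \<Longrightarrow> ip z (x \<oplus>\<^bsub>H\<^esub> y) = ip z x + ip z y"
  using cinner_commute[of z "x \<oplus>\<^bsub>H\<^esub> y"] cinner_commute[of z x] cinner_commute[of z y]
  by (simp add: ip_add_left)

lemma ip_smult_left: "x \<in> V \<Longrightarrow> y \<in> V \<Longrightarrow> ip (c \<odot>\<^bsub>H\<^esub> x) y = c * ip x y"
  by (rule cinner_smult_left)

lemma ip_smult_right: "x \<in> V \<Longrightarrow> y \<in> V \<Longrightarrow> ip x (c \<odot>\<^bsub>H\<^esub> y) = cnj c * ip x y"
  using cinner_commute[of x "c \<odot>\<^bsub>H\<^esub> y"] cinner_commute[of x y] by (simp add: ip_smult_left)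

lemma ip_diff_left: "x \<in> V \<Longrightarrow> y \<in> V \<Longrightarrow> z \<in> V \<Longrightarrow> ip (x \<ominus>\<^bsub>H\<^esub> y) z = ip x z - ip y z"
  by (simp add: diff_eq ip_add_left ip_smult_left)

lemma ip_diff_right: "x \<in> V \<Longrightarrow> y \<in> V \<Longrightarrow> z \<in> V \<Longrightarrow> ip z (x \<ominus>\<^bsub>H\<^esub> y) = ip z x - ip z y"
  by (simp add: diff_eq ip_add_right ip_smult_right)

lemma ip_zero_left [simp]: "x \<in> V \<Longrightarrow> ip \<zero>\<^bsub>H\<^esub> x = 0"
  using ip_smult_left[of "\<zero>\<^bsub>H\<^esub>" x 0] smult_l_null[of "\<zero>\<^bsub>H\<^esub>"] by simp

lemma ip_zero_right [simp]: "x \<in> V \<Longrightarrow> ip x \<zero>\<^bsub>H\<^esub> = 0"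
  using ip_smult_right[of x "\<zero>\<^bsub>H\<^esub>" 0] smult_l_null[of "\<zero>\<^bsub>H\<^esub>"] by simp

lemmas ip_lin = ip_add_left ip_add_right ip_smult_left ip_smult_right ip_diff_left ip_diff_right

lemma ip_finsum_left:
  assumes "finite A" "\<And>i. i \<in> A \<Longrightarrow> f i \<in> V" "y \<in> V"
  shows "ip (\<Oplus>\<^bsub>H\<^esub>i\<in>A. f i) y = (\<Sum>i\<in>A. ip (f i) y)"
  using assms by (induction A) (auto simp: M.finsum_insert Pi_def ip_add_left)

lemma ip_self_real: "x \<in> V \<Longrightarrow> ip x x = of_real (Re (ip x x))"
  using cinner_commute[of x x] by (simp add: complex_eq_iff)

lemma Re_ip_self_nonneg: "x \<in> V \<Longrightarrow> 0 \<le> Re (ip x x)"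
  using cinner_pos[of x] by (cases "x = \<zero>\<^bsub>H\<^esub>") auto

lemma nrm_nonneg [simp]: "x \<in> V \<Longrightarrow> 0 \<le> nrm x"
  by (simp add: vnorm_def Re_ip_self_nonneg)

lemma nrm_sq: "x \<in> V \<Longrightarrow> (nrm x)\<^sup>2 = Re (ip x x)"
  by (simp add: vnorm_def Re_ip_self_nonneg)

lemma ip_self: "x \<in> V \<Longrightarrow> ip x x = of_real ((nrm x)\<^sup>2)"
  using ip_self_real[of x] nrm_sq[of x] by simp

lemma cmod_ip_self: "x \<in> V \<Longrightarrow> cmod (ip x x) = (nrm x)\<^sup>2"
  by (simp add: ip_self norm_power)

lemma nrm_zero [simp]: "nrm \<zero>\<^bsub>H\<^esub> = 0"
  by (simp add: vnorm_def)

lemma nrm_eq_0: "x \<in> V \<Longrightarrow> nrm x = 0 \<longleftrightarrow> x = \<zero>\<^bsub>H\<^esub>"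
  using cinner_pos[of x] by (cases "x = \<zero>\<^bsub>H\<^esub>") (auto simp: vnorm_def)

lemma nrm_smult: "x \<in> V \<Longrightarrow> nrm (c \<odot>\<^bsub>H\<^esub> x) = cmod c * nrm x"
proof -
  assume x: "x \<in> V"
  have "ip (c \<odot>\<^bsub>H\<^esub> x) (c \<odot>\<^bsub>H\<^esub> x) = c * cnj c * ip x x"
    using x by (simp add: ip_smult_left ip_smult_right)
  also have "\<dots> = of_real ((cmod c * nrm x)\<^sup>2)"
    using x by (simp add: ip_self complex_norm_square[symmetric] power_mult_distrib)
  finally have "(nrm (c \<odot>\<^bsub>H\<^esub> x))\<^sup>2 = (cmod c * nrm x)\<^sup>2"
    using x nrm_sq[of "c \<odot>\<^bsub>H\<^esub> x"] by (metis Re_complex_of_real smult_in)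
  then show ?thesis using x by (simp add: power2_eq_iff_nonneg)
qed

lemma ip_cauchy_schwarz:
  assumes x: "x \<in> V" and y: "y \<in> V"
  shows "cmod (ip x y) \<le> nrm x * nrm y"
proof (cases "nrm y = 0")
  case True
  then show ?thesis using y nrm_eq_0[of y] x by simp
next
  case False
  then have py: "nrm y > 0" using y nrm_nonneg[of y] by linarith
  define c where "c = ip x y / of_real ((nrm y)\<^sup>2)"
  define w where "w = x \<ominus>\<^bsub>H\<^esub> c \<odot>\<^bsub>H\<^esub> y"
  have w: "w \<in> V" using x y by (simp add: w_def)
  have "ip w y = 0"
    using x y False by (simp add: w_def ip_lin ip_self[OF y] c_def)
  then have "ip w w = ip x w - c * cnj (ip w y)"
    using ip_diff_left[of x "c \<odot>\<^bsub>H\<^esub> y" w] ip_smult_left[of y w c] cinner_commute[of y w] x y w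
    by (simp flip: w_def)
  also have "\<dots> = ip x w" using \<open>ip w y = 0\<close> by simp
  also have "\<dots> = ip x x - cnj c * ip x y"
    using x y by (simp add: w_def ip_diff_right ip_smult_right)
  also have "cnj c * ip x y = of_real ((cmod (ip x y))\<^sup>2 / (nrm y)\<^sup>2)"
    unfolding of_real_divide complex_norm_square by (simp add: c_def)
  finally have "ip w w = of_real ((nrm x)\<^sup>2 - (cmod (ip x y))\<^sup>2 / (nrm y)\<^sup>2)"
    unfolding of_real_diff ip_self[OF x] .
  then have "0 \<le> (nrm x)\<^sup>2 - (cmod (ip x y))\<^sup>2 / (nrm y)\<^sup>2"
    using Re_ip_self_nonneg[OF w] Re_complex_of_real by metis
  then have "(cmod (ip x y))\<^sup>2 \<le> (nrm x * nrm y)\<^sup>2"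
    using py by (simp add: pos_divide_le_eq power_mult_distrib)
  then show ?thesis using x y power2_le_imp_le[of "cmod (ip x y)" "nrm x * nrm y"] by simp
qed

lemma ip_eqI:
  assumes "x \<in> V" "y \<in> V" "\<And>z. z \<in> V \<Longrightarrow> ip x z = ip y z"
  shows "x = y"
proof -
  have "ip (x \<ominus>\<^bsub>H\<^esub> y) (x \<ominus>\<^bsub>H\<^esub> y) = 0"
    using assms ip_diff_left[of x y "x \<ominus>\<^bsub>H\<^esub> y"] by simp
  then have "nrm (x \<ominus>\<^bsub>H\<^esub> y) = 0" by (simp add: vnorm_def)
  then have "x \<ominus>\<^bsub>H\<^esub> y = \<zero>\<^bsub>H\<^esub>" using assms nrm_eq_0 by simp
  then show ?thesis
    using assms M.minus_equality[of x "\<ominus>\<^bsub>H\<^esub> y"] by (simp add: a_minus_def)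
qed

lemma ip_eqI':
  assumes "x \<in> V" "y \<in> V" "\<And>z. z \<in> V \<Longrightarrow> ip z x = ip z y"
  shows "x = y"
proof (rule ip_eqI)
  fix z assume "z \<in> V"
  then show "ip x z = ip y z"
    using assms cinner_commute[of x z] cinner_commute[of y z] by simp
qed (use assms in auto)

section \<open>Bounded operators\<close>

lemma bounded_opsD:
  assumes "T \<in> bounded_ops H"
  shows bop_in: "x \<in> V \<Longrightarrow> T x \<in> V"
    and bop_add: "x \<in> V \<Longrightarrow> y \<in> V \<Longrightarrow> T (x \<oplus>\<^bsub>H\<^esub> y) = T x \<oplus>\<^bsub>H\<^esub> T y"
    and bop_smult: "x \<in> V \<Longrightarrow> T (c \<odot>\<^bsub>H\<^esub> x) = c \<odot>\<^bsub>H\<^esub> T x"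
    and bop_ext: "x \<notin> V \<Longrightarrow> T x = undefined"
  using assms by (simp_all add: bounded_ops_def PiE_iff extensional_def)

lemma bop_bound:
  assumes "T \<in> bounded_ops H"
  shows "\<exists>C>0. \<forall>x\<in>V. nrm (T x) \<le> C * nrm x"
proof -
  obtain C where C: "\<And>x. x \<in> V \<Longrightarrow> nrm (T x) \<le> C * nrm x"
    using assms unfolding bounded_ops_def by blast
  have "nrm (T x) \<le> (\<bar>C\<bar> + 1) * nrm x" if "x \<in> V" for x
    using C[OF that] mult_right_mono[of C "\<bar>C\<bar> + 1" "nrm x"] nrm_nonneg[OF that] by linarith
  then show ?thesis by (intro exI[of _ "\<bar>C\<bar> + 1"]) auto
qed

text \<open>Inner products determine vectors, so linearity and boundedness may be checked weakly.  Since
  \<open>ip (op_sum H f A x) y\<close> is an ordinary finite sum of complex numbers, this avoids calculations with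
  sums in the module.\<close>

lemma bounded_opsI:
  assumes ext: "T \<in> extensional V" and in_V: "\<And>x. x \<in> V \<Longrightarrow> T x \<in> V"
    and add: "\<And>x y z. x \<in> V \<Longrightarrow> y \<in> V \<Longrightarrow> z \<in> V \<Longrightarrow> ip (T (x \<oplus>\<^bsub>H\<^esub> y)) z = ip (T x) z + ip (T y) z"
    and smult: "\<And>c x z. x \<in> V \<Longrightarrow> z \<in> V \<Longrightarrow> ip (T (c \<odot>\<^bsub>H\<^esub> x)) z = c * ip (T x) z"
    and bd: "\<And>x z. x \<in> V \<Longrightarrow> z \<in> V \<Longrightarrow> cmod (ip (T x) z) \<le> C * nrm x * nrm z"
  shows "T \<in> bounded_ops H"
proof -
  have "nrm (T x) \<le> \<bar>C\<bar> * nrm x" if x: "x \<in> V" for x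
  proof -
    have "(nrm (T x))\<^sup>2 \<le> C * nrm x * nrm (T x)"
      using bd[OF x in_V[OF x]] x in_V by (simp add: cmod_ip_self)
    also have "\<dots> \<le> \<bar>C\<bar> * nrm x * nrm (T x)"
      using x in_V by (intro mult_right_mono) auto
    finally have "nrm (T x) * nrm (T x) \<le> (\<bar>C\<bar> * nrm x) * nrm (T x)"
      by (simp add: power2_eq_square)
    then show ?thesis
      using mult_right_le_imp_le[of "nrm (T x)" "nrm (T x)"] in_V[OF x] x
      by (cases "nrm (T x) = 0") (auto simp: less_le)
  qed
  moreover have "T (x \<oplus>\<^bsub>H\<^esub> y) = T x \<oplus>\<^bsub>H\<^esub> T y" if "x \<in> V" "y \<in> V" for x y
    using that in_V add by (intro ip_eqI) (auto simp: ip_lin)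
  moreover have "T (c \<odot>\<^bsub>H\<^esub> x) = c \<odot>\<^bsub>H\<^esub> T x" if "x \<in> V" for c x
    using that in_V smult by (intro ip_eqI) (auto simp: ip_lin)
  moreover have "T \<in> V \<rightarrow>\<^sub>E V" using ext in_V by (auto simp: PiE_def)
  ultimately show ?thesis unfolding bounded_ops_def by blast
qed

lemma bop_eqI:
  assumes "S \<in> bounded_ops H" "T \<in> bounded_ops H"
    and "\<And>x y. x \<in> V \<Longrightarrow> y \<in> V \<Longrightarrow> ip (S x) y = ip (T x) y"
  shows "S = T"
proof
  fix x show "S x = T x"
  proof (cases "x \<in> V")
    case True
    then show ?thesis
      using assms bop_in[OF assms(1)] bop_in[OF assms(2)] by (intro ip_eqI) auto
  next
    case False
    then show ?thesis using bop_ext[OF assms(1)] bop_ext[OF assms(2)] by simp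
  qed
qed

lemma nrm_le_if_ip_le:
  assumes "w \<in> V" "C \<ge> 0" "cmod (ip w w) \<le> C * nrm w"
  shows "nrm w \<le> C"
proof -
  have "nrm w * nrm w \<le> C * nrm w"
    using assms by (simp add: cmod_ip_self power2_eq_square[symmetric])
  then show ?thesis
    using assms mult_right_le_imp_le[of "nrm w" "nrm w" C] nrm_nonneg[of w]
    by (cases "nrm w = 0") (auto simp: less_le)
qed

lemma op_id_bop [simp, intro]: "op_id H \<in> bounded_ops H"
  by (auto simp: bounded_ops_def op_id_def intro!: exI[of _ 1])

lemma op_mult_apply: "x \<in> V \<Longrightarrow> op_mult H S T x = S (T x)"
  by (simp add: op_mult_def compose_def)

lemma bop_mult [simp, intro]:
  assumes S: "S \<in> bounded_ops H" and T: "T \<in> bounded_ops H"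
  shows "op_mult H S T \<in> bounded_ops H"
proof -
  obtain C where C: "C > 0" "\<And>x. x \<in> V \<Longrightarrow> nrm (S x) \<le> C * nrm x" using bop_bound[OF S] by blast
  obtain D where D: "D > 0" "\<And>x. x \<in> V \<Longrightarrow> nrm (T x) \<le> D * nrm x" using bop_bound[OF T] by blast
  note in_V = bop_in[OF S bop_in[OF T]]
  show ?thesis
  proof (rule bounded_opsI[where C = "C * D"])
    fix x z assume xz: "x \<in> V" "z \<in> V"
    have "nrm (S (T x)) \<le> C * D * nrm x"
      using order_trans[OF C(2)[OF bop_in[OF T xz(1)]] mult_left_mono[OF D(2)[OF xz(1)], of C]] C(1)
      by (simp add: mult.assoc)
    then have "nrm (S (T x)) * nrm z \<le> C * D * nrm x * nrm z"
      using xz by (intro mult_right_mono) auto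
    then show "cmod (ip (op_mult H S T x) z) \<le> C * D * nrm x * nrm z"
      using ip_cauchy_schwarz[OF in_V[OF xz(1)] xz(2)] xz by (simp add: op_mult_apply)
  qed (simp_all add: in_V op_mult_apply bop_in[OF T] bop_in[OF S] bop_add[OF T] bop_add[OF S]
      bop_smult[OF T] bop_smult[OF S] ip_lin, simp add: op_mult_def compose_def)
qed

lemma op_id_apply: "x \<in> V \<Longrightarrow> op_id H x = x"
  by (simp add: op_id_def)

lemma op_scale_apply: "x \<in> V \<Longrightarrow> op_scale H c T x = c \<odot>\<^bsub>H\<^esub> T x"
  by (simp add: op_scale_def)

lemma op_diff_apply: "x \<in> V \<Longrightarrow> op_diff H S T x = S x \<ominus>\<^bsub>H\<^esub> T x"
  by (simp add: op_diff_def)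

lemma op_sum_in:
  assumes "\<And>i. i \<in> A \<Longrightarrow> f i x \<in> V" "x \<in> V"
  shows "op_sum H f A x \<in> V"
  using assms by (auto simp: op_sum_def intro!: M.finsum_closed)

lemma ip_op_sum:
  assumes "finite A" "\<And>i. i \<in> A \<Longrightarrow> f i x \<in> V" "x \<in> V" "y \<in> V"
  shows "ip (op_sum H f A x) y = (\<Sum>i\<in>A. ip (f i x) y)"
  using assms by (simp add: op_sum_def ip_finsum_left)

lemma bop_ip_bound:
  assumes "T \<in> bounded_ops H" "\<And>x. x \<in> V \<Longrightarrow> nrm (T x) \<le> C * nrm x" "x \<in> V" "y \<in> V"
  shows "cmod (ip (T x) y) \<le> C * nrm x * nrm y"
  using ip_cauchy_schwarz[OF bop_in[OF assms(1,3)] assms(4)]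
    mult_right_mono[OF assms(2)[OF assms(3)], of "nrm y"] assms by auto

lemma bop_scale [simp, intro]:
  assumes T: "T \<in> bounded_ops H"
  shows "op_scale H c T \<in> bounded_ops H"
proof -
  obtain C where C: "C > 0" "\<And>x. x \<in> V \<Longrightarrow> nrm (T x) \<le> C * nrm x" using bop_bound[OF T] by blast
  show ?thesis
  proof (rule bounded_opsI[where C = "cmod c * C"])
    fix x z assume "x \<in> V" "z \<in> V"
    then show "cmod (ip (op_scale H c T x) z) \<le> cmod c * C * nrm x * nrm z"
      using bop_in[OF T] bop_ip_bound[OF T C(2), of x z] mult_left_mono[of _ _ "cmod c"]
      by (simp add: op_scale_apply ip_lin norm_mult mult.assoc)
  qed (use bounded_opsD[OF T] in \<open>auto simp: op_scale_apply ip_lin algebra_simps, auto simp: op_scale_def\<close>)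
qed

lemma bop_diff [simp, intro]:
  assumes S: "S \<in> bounded_ops H" and T: "T \<in> bounded_ops H"
  shows "op_diff H S T \<in> bounded_ops H"
proof -
  obtain C where C: "C > 0" "\<And>x. x \<in> V \<Longrightarrow> nrm (S x) \<le> C * nrm x" using bop_bound[OF S] by blast
  obtain D where D: "D > 0" "\<And>x. x \<in> V \<Longrightarrow> nrm (T x) \<le> D * nrm x" using bop_bound[OF T] by blast
  show ?thesis
  proof (rule bounded_opsI[where C = "C + D"])
    fix x z assume xz: "x \<in> V" "z \<in> V"
    show "cmod (ip (op_diff H S T x) z) \<le> (C + D) * nrm x * nrm z"
      using xz bop_in[OF T] bop_in[OF S] bop_ip_bound[OF T D(2) xz] bop_ip_bound[OF S C(2) xz]
        norm_triangle_ineq4[of "ip (S x) z" "ip (T x) z"]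
      by (simp add: op_diff_apply ip_lin algebra_simps)
  qed (use bounded_opsD[OF T] bounded_opsD[OF S] in
      \<open>auto simp: op_diff_apply ip_lin algebra_simps, auto simp: op_diff_def\<close>)
qed

lemma bop_sum [intro]:
  assumes "finite A" and f: "\<And>i. i \<in> A \<Longrightarrow> f i \<in> bounded_ops H"
  shows "op_sum H f A \<in> bounded_ops H"
proof -
  have "\<forall>i\<in>A. \<exists>C. \<forall>x\<in>V. nrm (f i x) \<le> C * nrm x"
    using bop_bound[OF f] by metis
  then obtain C where C: "\<And>i x. i \<in> A \<Longrightarrow> x \<in> V \<Longrightarrow> nrm (f i x) \<le> C i * nrm x"
    by metis
  have fin: "f i x \<in> V" if "i \<in> A" "x \<in> V" for i x using bop_in[OF f] that by blast
  have ip_sum: "ip (op_sum H f A x) y = (\<Sum>i\<in>A. ip (f i x) y)" if "x \<in> V" "y \<in> V" for x y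
    using ip_op_sum[where f = f and A = A, OF assms(1)] fin that by blast
  show ?thesis
  proof (rule bounded_opsI[where C = "\<Sum>i\<in>A. C i"])
    fix x z assume xz: "x \<in> V" "z \<in> V"
    have "cmod (\<Sum>i\<in>A. ip (f i x) z) \<le> (\<Sum>i\<in>A. C i * nrm x * nrm z)"
      using bop_ip_bound[OF f C xz] by (intro order_trans[OF norm_sum] sum_mono) auto
    then show "cmod (ip (op_sum H f A x) z) \<le> (\<Sum>i\<in>A. C i) * nrm x * nrm z"
      using xz by (simp add: ip_sum sum_distrib_right)
  qed (use fin in \<open>auto simp: ip_sum op_sum_in bop_add[OF f] bop_smult[OF f] ip_lin sum.distrib
      sum_distrib_left\<close>, auto simp: op_sum_def)
qed

lemma op_norm_bdd_above:
  assumes T: "T \<in> bounded_ops H"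
  shows "bdd_above ((\<lambda>x. nrm (T x)) ` {x \<in> V. nrm x \<le> 1})"
proof -
  obtain C where C: "C > 0" "\<And>x. x \<in> V \<Longrightarrow> nrm (T x) \<le> C * nrm x" using bop_bound[OF T] by blast
  have "nrm (T x) \<le> C" if "x \<in> V" "nrm x \<le> 1" for x
    using order_trans[OF C(2)[OF that(1)] mult_left_mono[OF that(2), of C]] C(1) by simp
  then show ?thesis by (auto simp: bdd_above_def)
qed

lemma op_norm_bound:
  assumes T: "T \<in> bounded_ops H" and x: "x \<in> V"
  shows "nrm (T x) \<le> op_norm H T * nrm x"
proof (cases "nrm x = 0")
  case True
  then show ?thesis
    using bop_bound[OF T] x by (metis mult_zero_right)
next
  case False
  then have p: "nrm x > 0" using x nrm_nonneg[of x] by linarith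
  define y where "y = of_real (1 / nrm x) \<odot>\<^bsub>H\<^esub> x"
  have y: "y \<in> V" "nrm y = 1" using x p by (auto simp: y_def nrm_smult norm_divide)
  have "nrm (T y) \<le> op_norm H T"
    unfolding op_norm_def using y by (intro cSUP_upper op_norm_bdd_above[OF T]) auto
  moreover have "nrm (T y) = nrm (T x) / nrm x"
    using x p bop_in[OF T x] by (simp add: y_def bop_smult[OF T] nrm_smult norm_divide)
  ultimately show ?thesis using p by (simp add: field_simps)
qed

lemma op_norm_le:
  assumes "C \<ge> 0" "\<And>x. x \<in> V \<Longrightarrow> nrm (T x) \<le> C * nrm x"
  shows "op_norm H T \<le> C"
  unfolding op_norm_def
proof (rule cSUP_least)
  show "{x \<in> V. nrm x \<le> 1} \<noteq> {}" by (auto intro!: exI[of _ "\<zero>\<^bsub>H\<^esub>"])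
  fix x assume "x \<in> {x \<in> V. nrm x \<le> 1}"
  then show "nrm (T x) \<le> C"
    using assms(2)[of x] mult_left_mono[of "nrm x" 1 C] assms(1) by auto
qed

lemma op_norm_nonneg:
  assumes T: "T \<in> bounded_ops H"
  shows "op_norm H T \<ge> 0"
  unfolding op_norm_def using bop_in[OF T]
  by (intro cSUP_upper2[OF op_norm_bdd_above[OF T], of "\<zero>\<^bsub>H\<^esub>"]) auto

lemma ip_le_op_norm:
  assumes T: "T \<in> bounded_ops H" and "x \<in> V" "y \<in> V"
  shows "cmod (ip (T x) y) \<le> op_norm H T * nrm x * nrm y"
  using bop_ip_bound[OF T op_norm_bound[OF T]] assms by blast

section \<open>The variational principle and adjoints\<close>

text \<open>The minimizer of the energy \<open>J x = \<langle>A x, x\<rangle> - 2 Re (f x)\<close> represents the functional \<open>f\<close>.  For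
  \<open>A = I\<close> this is the Riesz representation theorem; for \<open>f x = \<langle>x, y\<rangle>\<close> it solves \<open>A z = y\<close>.\<close>

lemma coercive_representation:
  assumes A: "A \<in> bounded_ops H"
    and sym: "\<And>x y. x \<in> V \<Longrightarrow> y \<in> V \<Longrightarrow> ip (A x) y = ip x (A y)"
    and d: "d > 0" and coercive: "\<And>x. x \<in> V \<Longrightarrow> d * (nrm x)\<^sup>2 \<le> Re (ip (A x) x)"
    and f_add: "\<And>x y. x \<in> V \<Longrightarrow> y \<in> V \<Longrightarrow> f (x \<oplus>\<^bsub>H\<^esub> y) = f x + f y"
    and f_smult: "\<And>c x. x \<in> V \<Longrightarrow> f (c \<odot>\<^bsub>H\<^esub> x) = c * f x"
    and f_bound: "\<And>x. x \<in> V \<Longrightarrow> cmod (f x) \<le> C * nrm x"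
  obtains z where "z \<in> V" "\<And>x. x \<in> V \<Longrightarrow> f x = ip (A x) z"
proof -
  note Ain [simp] = bop_in[OF A]
  define B where "B x y = Re (ip (A x) y)" for x y
  define J where "J x = B x x - 2 * Re (f x)" for x
  have B_sym: "B x y = B y x" if "x \<in> V" "y \<in> V" for x y
    using that sym[of x y] cinner_commute[of x "A y"] by (simp add: B_def)
  have B_add: "B (x \<oplus>\<^bsub>H\<^esub> y) z = B x z + B y z" if "x \<in> V" "y \<in> V" "z \<in> V" for x y z
    using that by (simp add: B_def bop_add[OF A] ip_lin)
  have B_smult: "B (of_real t \<odot>\<^bsub>H\<^esub> x) y = t * B x y" if "x \<in> V" "y \<in> V" for t x y
    using that by (simp add: B_def bop_smult[OF A] ip_lin)
  have f_lin: "Re (f (of_real t \<odot>\<^bsub>H\<^esub> x)) = t * Re (f x)" if "x \<in> V" for t x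
    using that by (simp add: f_smult)
  have B_comb: "B (x \<oplus>\<^bsub>H\<^esub> of_real t \<odot>\<^bsub>H\<^esub> y) (x \<oplus>\<^bsub>H\<^esub> of_real t \<odot>\<^bsub>H\<^esub> y)
      = B x x + 2 * t * B x y + t\<^sup>2 * B y y" if "x \<in> V" "y \<in> V" for t x y
  proof -
    have ty: "of_real t \<odot>\<^bsub>H\<^esub> y \<in> V" using that by simp
    have "B y (x \<oplus>\<^bsub>H\<^esub> of_real t \<odot>\<^bsub>H\<^esub> y) = B x y + t * B y y"
      using that ty by (subst B_sym) (simp_all add: B_add B_smult)
    moreover have "B x (x \<oplus>\<^bsub>H\<^esub> of_real t \<odot>\<^bsub>H\<^esub> y) = B x x + t * B x y"
      using that ty B_sym[of x y] by (subst B_sym) (simp_all add: B_add B_smult)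
    ultimately show ?thesis
      using that ty by (simp add: B_add B_smult algebra_simps power2_eq_square)
  qed
  have J_comb: "J (x \<oplus>\<^bsub>H\<^esub> of_real t \<odot>\<^bsub>H\<^esub> y) = J x + 2 * t * (B x y - Re (f y)) + t\<^sup>2 * B y y"
    if "x \<in> V" "y \<in> V" for t x y
    using that by (simp add: J_def B_comb f_add f_lin algebra_simps)
  \<comment> \<open>Completing the square shows that the energy is bounded below.\<close>
  have J_below: "- (C\<^sup>2 / d) \<le> J x" if x: "x \<in> V" for x
  proof -
    have "Re (f x) \<le> C * nrm x"
      using f_bound[OF x] complex_Re_le_cmod[of "f x"] by linarith
    then have "d * (nrm x)\<^sup>2 - 2 * (C * nrm x) \<le> J x"
      using coercive[OF x] by (simp add: J_def B_def)
    moreover have "0 \<le> (d * nrm x - C)\<^sup>2 / d" using d by simp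
    then have "- (C\<^sup>2 / d) \<le> d * (nrm x)\<^sup>2 - 2 * (C * nrm x)"
      using d by (simp add: power2_diff divide_simps) (simp add: algebra_simps power2_eq_square)
    ultimately show ?thesis by linarith
  qed
  define m where "m = Inf (J ` V)"
  have bdd: "bdd_below (J ` V)" using J_below by (auto simp: bdd_below_def)
  have m_le: "m \<le> J x" if "x \<in> V" for x
    unfolding m_def using that bdd by (intro cInf_lower) auto
  have "\<exists>x\<in>V. J x < m + 1 / real (Suc l)" for l
  proof -
    have "J ` V \<noteq> {}" by auto
    moreover have "Inf (J ` V) < m + 1 / real (Suc l)" by (simp add: m_def)
    ultimately show ?thesis using cInf_lessD[of "J ` V"] by blast
  qed
  then obtain u where u: "\<And>l. u l \<in> V" "\<And>l. J (u l) < m + 1 / real (Suc l)" by metis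
  \<comment> \<open>The energy at the midpoint of two near-minimizers is at least \<open>m\<close>; by the parallelogram law
    the near-minimizers are close to each other, so that a minimizing sequence is Cauchy.\<close>
  have gap: "d * (nrm (u l \<ominus>\<^bsub>H\<^esub> u j))\<^sup>2 \<le> 2 / real (Suc l) + 2 / real (Suc j)" for l j
  proof -
    define w where "w = u l \<ominus>\<^bsub>H\<^esub> u j"
    have w: "w \<in> V" using u by (simp add: w_def)
    have ul: "u l = u j \<oplus>\<^bsub>H\<^esub> of_real 1 \<odot>\<^bsub>H\<^esub> w"
      using u by (intro ip_eqI) (auto simp: w_def ip_lin)
    have "J (u l) = J (u j) + 2 * (B (u j) w - Re (f w)) + B w w"
      by (subst ul, subst J_comb) (use u w in auto)
    moreover have "m \<le> J (u j \<oplus>\<^bsub>H\<^esub> of_real (1/2) \<odot>\<^bsub>H\<^esub> w)" using u w by (intro m_le) simp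
    then have "m \<le> J (u j) + (B (u j) w - Re (f w)) + B w w / 4"
      by (subst (asm) J_comb) (use u w in \<open>auto simp: power2_eq_square\<close>)
    moreover have "d * (nrm w)\<^sup>2 \<le> B w w" using coercive[OF w] by (simp add: B_def)
    moreover have "b \<le> 2 * p + 2 * q"
      if "s = t + 2 * e + c" "m \<le> t + e + c / 4" "b \<le> c" "s < m + p" "t < m + q"
      for s t e c b p q :: real using that by linarith
    ultimately have "d * (nrm w)\<^sup>2 \<le> 2 * (1 / real (Suc l)) + 2 * (1 / real (Suc j))"
      using u(2)[of l] u(2)[of j] by blast
    then show ?thesis by (simp add: w_def)
  qed
  have "\<exists>N. \<forall>l\<ge>N. \<forall>j\<ge>N. nrm (u l \<ominus>\<^bsub>H\<^esub> u j) < e" if e: "e > 0" for e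
  proof -
    obtain N where N: "1 / real (Suc N) < d * e\<^sup>2 / 4"
      using reals_Archimedean[of "d * e\<^sup>2 / 4"] d e by (auto simp: field_simps)
    have "nrm (u l \<ominus>\<^bsub>H\<^esub> u j) < e" if "l \<ge> N" "j \<ge> N" for l j
    proof -
      have "1 / real (Suc l) \<le> 1 / real (Suc N)" "1 / real (Suc j) \<le> 1 / real (Suc N)"
        using that by (auto simp: frac_le)
      then have "d * (nrm (u l \<ominus>\<^bsub>H\<^esub> u j))\<^sup>2 < d * e\<^sup>2"
        using gap[of l j] N by simp
      then have "(nrm (u l \<ominus>\<^bsub>H\<^esub> u j))\<^sup>2 < e\<^sup>2" using d by simp
      then show ?thesis using less_imp_le[OF e] by (rule power2_less_imp_less)
    qed
    then show ?thesis by blast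
  qed
  then obtain z where z: "z \<in> V" "(\<lambda>l. nrm (u l \<ominus>\<^bsub>H\<^esub> z)) \<longlonglongrightarrow> 0"
    using complete[of u] u(1) by blast
  obtain K where K: "K > 0" "\<And>x. x \<in> V \<Longrightarrow> nrm (A x) \<le> K * nrm x" using bop_bound[OF A] by blast
  have Re_eq: "B z y = Re (f y)" if y: "y \<in> V" for y
  proof -
    have lim: "(\<lambda>l. B (u l) y) \<longlonglongrightarrow> B z y"
    proof (rule Lim_transform2[OF tendsto_const])
      have "(\<lambda>l. K * nrm (u l \<ominus>\<^bsub>H\<^esub> z) * nrm y) \<longlonglongrightarrow> K * 0 * nrm y"
        by (intro tendsto_intros z)
      moreover have "norm (B z y - B (u l) y) \<le> K * nrm (u l \<ominus>\<^bsub>H\<^esub> z) * nrm y" for l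
      proof -
        have "u l = z \<oplus>\<^bsub>H\<^esub> (u l \<ominus>\<^bsub>H\<^esub> z)"
          using u z by (intro ip_eqI) (auto simp: ip_lin)
        then have "B (u l) y = B z y + B (u l \<ominus>\<^bsub>H\<^esub> z) y"
          using B_add[of z "u l \<ominus>\<^bsub>H\<^esub> z" y] u z y by simp
        then have "norm (B z y - B (u l) y) = \<bar>B (u l \<ominus>\<^bsub>H\<^esub> z) y\<bar>" by simp
        also have "\<dots> \<le> cmod (ip (A (u l \<ominus>\<^bsub>H\<^esub> z)) y)" by (simp add: B_def abs_Re_le_cmod)
        also have "\<dots> \<le> K * nrm (u l \<ominus>\<^bsub>H\<^esub> z) * nrm y"
          using bop_ip_bound[OF A K(2)] u z y by simp
        finally show ?thesis .
      qed
      ultimately show "(\<lambda>l. B z y - B (u l) y) \<longlonglongrightarrow> 0"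
        using Lim_null_comparison[of "\<lambda>l. B z y - B (u l) y"
            "\<lambda>l. K * nrm (u l \<ominus>\<^bsub>H\<^esub> z) * nrm y" sequentially] by simp
    qed
    \<comment> \<open>The first variation at the limit, obtained from \<open>J (u l + t y) \<ge> m > J (u l) - 1 / (l + 1)\<close>.\<close>
    have quad: "0 \<le> 2 * t * (B z y - Re (f y)) + t\<^sup>2 * B y y" for t
    proof (rule LIMSEQ_le)
      show "(\<lambda>l. - (1 / real (Suc l))) \<longlonglongrightarrow> 0"
        using tendsto_minus[OF LIMSEQ_Suc[OF lim_1_over_n]] by (simp add: o_def)
      show "(\<lambda>l. 2 * t * (B (u l) y - Re (f y)) + t\<^sup>2 * B y y)
          \<longlonglongrightarrow> 2 * t * (B z y - Re (f y)) + t\<^sup>2 * B y y"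
        by (intro tendsto_intros lim)
      have "- (1 / real (Suc l)) \<le> 2 * t * (B (u l) y - Re (f y)) + t\<^sup>2 * B y y" for l
      proof -
        have "m \<le> J (u l \<oplus>\<^bsub>H\<^esub> of_real t \<odot>\<^bsub>H\<^esub> y)" using u y by (intro m_le) simp
        then show ?thesis using J_comb[OF u(1) y, of l t] u(2)[of l] by linarith
      qed
      then show "\<exists>N. \<forall>l\<ge>N. - (1 / real (Suc l))
          \<le> 2 * t * (B (u l) y - Re (f y)) + t\<^sup>2 * B y y" by blast
    qed
    define e where "e = B z y - Re (f y)"
    define b where "b = B y y"
    have b: "b \<ge> 0" using coercive[OF y] d
      by (metis B_def b_def mult_nonneg_nonneg order_less_imp_le order_trans zero_le_power2)
    \<comment> \<open>The minimizing \<open>t\<close> would be \<open>- e / b\<close>; adding 1 to the denominator keeps it positive.\<close>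
    define t where "t = - e / (b + 1)"
    have bt: "(b + 1) * t = - e" using b by (simp add: t_def)
    have "0 \<le> (b + 1)\<^sup>2 * (2 * t * e + t\<^sup>2 * b)"
      using quad[of t] by (simp add: e_def b_def)
    also have "\<dots> = 2 * (b + 1) * e * ((b + 1) * t) + ((b + 1) * t)\<^sup>2 * b"
      by (simp add: power2_eq_square algebra_simps)
    also have "\<dots> = - ((b + 2) * e\<^sup>2)"
      unfolding bt by (simp add: power2_eq_square algebra_simps)
    finally have "e = 0" using b by (auto simp: mult_le_0_iff)
    then show ?thesis by (simp add: e_def)
  qed
  have "f x = ip (A x) z" if x: "x \<in> V" for x
  proof (rule complex_eqI)
    show re: "Re (f x) = Re (ip (A x) z)"
      using Re_eq[OF x] B_sym[OF x z(1)] by (simp add: B_def)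
    \<comment> \<open>The real parts at \<open>\<i> x\<close> are the imaginary parts at \<open>x\<close>, up to sign.\<close>
    have "Re (f (\<i> \<odot>\<^bsub>H\<^esub> x)) = Re (ip (A (\<i> \<odot>\<^bsub>H\<^esub> x)) z)"
      using Re_eq[of "\<i> \<odot>\<^bsub>H\<^esub> x"] B_sym[of "\<i> \<odot>\<^bsub>H\<^esub> x" z] x z by (simp add: B_def)
    then show "Im (f x) = Im (ip (A x) z)"
      using x z by (simp add: f_smult bop_smult[OF A] ip_lin)
  qed
  then show ?thesis using that z(1) by blast
qed

lemma adj_props:
  assumes T: "T \<in> bounded_ops H" and y: "y \<in> V"
  shows adj_in: "adj H T y \<in> V"
    and adj_eq: "x \<in> V \<Longrightarrow> ip (T x) y = ip x (adj H T y)"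
proof -
  obtain C where C: "C > 0" "\<And>x. x \<in> V \<Longrightarrow> nrm (T x) \<le> C * nrm x" using bop_bound[OF T] by blast
  note Tin = bop_in[OF T]
  obtain z where z: "z \<in> V" "\<And>x. x \<in> V \<Longrightarrow> ip (T x) y = ip (op_id H x) z"
  proof (rule coercive_representation[of "op_id H" 1 "\<lambda>x. ip (T x) y" "C * nrm y"])
    fix x assume "x \<in> V"
    then show "cmod (ip (T x) y) \<le> C * nrm y * nrm x"
      using bop_ip_bound[OF T C(2)] y by (simp add: mult_ac)
  qed (use y Tin in \<open>auto simp: op_id_apply ip_self bop_add[OF T] bop_smult[OF T] ip_lin\<close>)
  then have z': "ip (T x) y = ip x z" if "x \<in> V" for x using that by (simp add: op_id_apply)
  have "adj H T y = z"
    unfolding adj_def using y z z' by (auto intro!: the_equality ip_eqI')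
  then show "adj H T y \<in> V" "x \<in> V \<Longrightarrow> ip (T x) y = ip x (adj H T y)"
    using z z' by auto
qed

lemma adj_eq': "T \<in> bounded_ops H \<Longrightarrow> x \<in> V \<Longrightarrow> y \<in> V \<Longrightarrow> ip (adj H T y) x = ip y (T x)"
  using adj_eq[of T y x] adj_in[of T y] bop_in cinner_commute by metis

lemma bop_adj [simp, intro]:
  assumes T: "T \<in> bounded_ops H"
  shows "adj H T \<in> bounded_ops H"
proof -
  obtain C where C: "C > 0" "\<And>x. x \<in> V \<Longrightarrow> nrm (T x) \<le> C * nrm x" using bop_bound[OF T] by blast
  show ?thesis
  proof (rule bounded_opsI[where C = C])
    fix x z assume "x \<in> V" "z \<in> V"
    then show "cmod (ip (adj H T x) z) \<le> C * nrm x * nrm z"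
      using bop_ip_bound[OF T C(2), of z x] adj_eq'[OF T, of z x]
        cinner_commute[of x "T z"] bop_in[OF T, of z] by (simp add: mult_ac)
  qed (use T adj_in[OF T] bop_in[OF T] in \<open>auto simp: adj_eq' ip_lin, auto simp: adj_def\<close>)
qed

end

section \<open>Defects of quadratic forms\<close>

text \<open>If \<open>S j\<close> is the adjoint of \<open>T j\<close> and \<open>q x = \<langle>Y x, x\<rangle>\<close>, then \<open>pull S m q\<close> is the quadratic form of
  \<open>Phi H m T Y\<close>.\<close>

definition pull :: "(nat \<Rightarrow> 'a \<Rightarrow> 'a) \<Rightarrow> nat \<Rightarrow> ('a \<Rightarrow> real) \<Rightarrow> 'a \<Rightarrow> real" where
  "pull S m q x = (\<Sum>j<m. q (S j x))"

text \<open>The map \<open>(id - t \<Phi>\<^sub>1) \<circ> \<dots> \<circ> (id - t \<Phi>\<^sub>k)\<close> on quadratic forms.  The parameter \<open>t\<close> accounts for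
  dilations: multiplying a tuple by \<open>z\<close> amounts to \<open>t = |z|\<^sup>2\<close>.\<close>

definition defect_form ::
  "real \<Rightarrow> (nat \<Rightarrow> nat \<Rightarrow> 'a \<Rightarrow> 'a) \<Rightarrow> (nat \<Rightarrow> nat) \<Rightarrow> nat list \<Rightarrow> ('a \<Rightarrow> real) \<Rightarrow> 'a \<Rightarrow> real" where
  "defect_form t S n L q = foldr (\<lambda>i q x. q x - t * pull (S i) (n i) q x) L q"

lemma defect_form_Nil [simp]: "defect_form t S n [] q = q"
  by (simp add: defect_form_def)

lemma defect_form_Cons [simp]:
  "defect_form t S n (i # L) q x =
     defect_form t S n L q x - t * pull (S i) (n i) (defect_form t S n L q) x"
  by (simp add: defect_form_def)

text \<open>Here \<open>S i j\<close> stands for the adjoint of the operator \<open>X i j\<close> and \<open>N\<close> for the squared norm.  A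
  strict row contraction appears as \<open>\<Phi>\<^sub>i N \<le> c N\<close> with \<open>c < 1\<close>.\<close>

locale commuting_contractions =
  fixes V :: "'a set" and S :: "nat \<Rightarrow> nat \<Rightarrow> 'a \<Rightarrow> 'a" and n :: "nat \<Rightarrow> nat" and k :: nat
    and N :: "'a \<Rightarrow> real" and c :: real
  assumes S_in: "i < k \<Longrightarrow> j < n i \<Longrightarrow> x \<in> V \<Longrightarrow> S i j x \<in> V"
    and S_comm: "i < k \<Longrightarrow> i' < k \<Longrightarrow> i \<noteq> i' \<Longrightarrow> j < n i \<Longrightarrow> j' < n i' \<Longrightarrow> x \<in> V \<Longrightarrow>
      S i j (S i' j' x) = S i' j' (S i j x)"
    and N_nonneg: "x \<in> V \<Longrightarrow> 0 \<le> N x"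
    and c: "0 \<le> c" "c < 1"
    and contr: "i < k \<Longrightarrow> x \<in> V \<Longrightarrow> pull (S i) (n i) N x \<le> c * N x"
begin

lemma pull_mono:
  assumes "\<And>x. x \<in> V \<Longrightarrow> q x \<le> q' x" "i < k" "x \<in> V"
  shows "pull (S i) (n i) q x \<le> pull (S i) (n i) q' x"
  unfolding pull_def using assms S_in by (intro sum_mono) auto

lemma pull_scale: "pull (S i) (n i) (\<lambda>x. a * q x) x = a * pull (S i) (n i) q x"
  by (simp add: pull_def sum_distrib_left)

lemma pull_nonneg:
  assumes "\<And>x. x \<in> V \<Longrightarrow> 0 \<le> q x" "i < k" "x \<in> V"
  shows "0 \<le> pull (S i) (n i) q x"
  unfolding pull_def using assms S_in by (intro sum_nonneg) auto

lemma pull_bound: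
  assumes q: "\<And>x. x \<in> V \<Longrightarrow> \<bar>q x\<bar> \<le> M * N x" and "M \<ge> 0" "i < k" and x: "x \<in> V"
  shows "\<bar>pull (S i) (n i) q x\<bar> \<le> M * c * N x"
proof -
  have "\<bar>pull (S i) (n i) q x\<bar> \<le> pull (S i) (n i) (\<lambda>x. \<bar>q x\<bar>) x"
    unfolding pull_def by (rule sum_abs)
  also have "\<dots> \<le> pull (S i) (n i) (\<lambda>x. M * N x) x"
    using q assms by (intro pull_mono) auto
  also have "\<dots> \<le> M * (c * N x)"
    using assms contr by (simp add: pull_scale mult_left_mono)
  finally show ?thesis by simp
qed

lemma pull_bound':
  assumes q: "\<And>x. x \<in> V \<Longrightarrow> \<bar>q x\<bar> \<le> M * N x" and M: "M \<ge> 0" and i: "i < k" and x: "x \<in> V"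
  shows "\<bar>pull (S i) (n i) q x\<bar> \<le> M * N x"
proof -
  have "M * c * N x \<le> M * 1 * N x"
    using c M N_nonneg[OF x] by (intro mult_right_mono mult_left_mono) auto
  then show ?thesis using pull_bound[OF q M i x] by simp
qed

text \<open>The map \<open>id - \<Phi>\<^sub>i\<close> has a positive inverse on bounded forms: a lower bound \<open>q \<ge> - M N\<close> improves to
  \<open>q \<ge> \<Phi>\<^sub>i q \<ge> - M c N\<close>, and the iteration of this step gives \<open>q \<ge> 0\<close>.  It replaces the Neumann series
  for \<open>(id - \<Phi>\<^sub>i)\<^sup>-\<^sup>1\<close>.\<close>

lemma inverse_positive:
  assumes i: "i < k" and q: "\<And>x. x \<in> V \<Longrightarrow> \<bar>q x\<bar> \<le> M * N x" and M: "M \<ge> 0"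
    and super: "\<And>x. x \<in> V \<Longrightarrow> pull (S i) (n i) q x \<le> q x"
    and x: "x \<in> V"
  shows "0 \<le> q x"
proof -
  have bound: "- (M * c ^ m) * N x \<le> q x" if "x \<in> V" for m x
    using that
  proof (induction m arbitrary: x)
    case 0
    then show ?case using q[of x] by auto
  next
    case (Suc m)
    have "- (M * c ^ Suc m) * N x = - (M * c ^ m) * (c * N x)" by simp
    also have "\<dots> \<le> - (M * c ^ m) * pull (S i) (n i) N x"
      using contr[OF i Suc.prems] M c by (intro mult_left_mono_neg) auto
    also have "\<dots> = pull (S i) (n i) (\<lambda>x. - (M * c ^ m) * N x) x" by (simp only: pull_scale)
    also have "\<dots> \<le> pull (S i) (n i) q x" using Suc.IH i Suc.prems by (intro pull_mono) auto
    also have "\<dots> \<le> q x" by (rule super[OF Suc.prems])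
    finally show ?case .
  qed
  have "(\<lambda>m. - (M * c ^ m) * N x) \<longlonglongrightarrow> - (M * 0) * N x"
    using c by (intro tendsto_intros LIMSEQ_realpow_zero) auto
  then show ?thesis using bound[OF x] by (intro LIMSEQ_le_const2[of _ 0]) auto
qed

text \<open>The factor for a further index \<open>i\<close> may be applied first or last, since the maps \<open>\<Phi>\<^sub>l\<close> commute.\<close>

lemma defect_form_pull:
  assumes "set L \<subseteq> {..<k}" "i < k" "i \<notin> set L" "x \<in> V"
  shows "defect_form t S n L (\<lambda>x. q x - s * pull (S i) (n i) q x) x =
     defect_form t S n L q x - s * pull (S i) (n i) (defect_form t S n L q) x"
  using assms
proof (induction L arbitrary: x)
  case (Cons l L)
  let ?D = "defect_form t S n L q" and ?E = "defect_form t S n L (\<lambda>x. q x - s * pull (S i) (n i) q x)"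
  have l: "l < k" "l \<noteq> i" and x: "x \<in> V" using Cons.prems by auto
  have IH: "?E y = ?D y - s * pull (S i) (n i) ?D y" if "y \<in> V" for y
    using Cons that by simp
  have "pull (S l) (n l) ?E x = (\<Sum>j<n l. ?D (S l j x) - s * (\<Sum>j'<n i. ?D (S i j' (S l j x))))"
    unfolding pull_def using IH S_in l x by (intro sum.cong) (auto simp: pull_def)
  also have "\<dots> = pull (S l) (n l) ?D x - s * (\<Sum>j<n l. \<Sum>j'<n i. ?D (S i j' (S l j x)))"
    by (simp add: sum_subtractf sum_distrib_left pull_def)
  also have "(\<Sum>j<n l. \<Sum>j'<n i. ?D (S i j' (S l j x))) = (\<Sum>j'<n i. \<Sum>j<n l. ?D (S l j (S i j' x)))"
    using S_comm[of i l _ _ x] l x Cons.prems by (subst sum.swap, intro sum.cong) auto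
  finally have *: "pull (S l) (n l) ?E x = pull (S l) (n l) ?D x
      - s * (\<Sum>j'<n i. pull (S l) (n l) ?D (S i j' x))" by (simp add: pull_def)
  have **: "pull (S i) (n i) (defect_form t S n (l # L) q) x
      = pull (S i) (n i) ?D x - t * (\<Sum>j'<n i. pull (S l) (n l) ?D (S i j' x))"
    by (simp add: pull_def sum_subtractf sum_distrib_left)
  show ?case
    unfolding ** by (simp only: defect_form_Cons IH[OF x] *) (simp add: algebra_simps)
qed simp

lemma defect_form_bounded:
  assumes "set L \<subseteq> {..<k}" and q: "\<And>x. x \<in> V \<Longrightarrow> \<bar>q x\<bar> \<le> M * N x" and M: "M \<ge> 0"
  shows "\<exists>K\<ge>0. \<forall>x\<in>V. \<bar>defect_form t S n L q x\<bar> \<le> K * N x"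
  using assms(1)
proof (induction L)
  case Nil
  then show ?case using q M by auto
next
  case (Cons i L)
  then obtain K where K: "K \<ge> 0" "\<And>x. x \<in> V \<Longrightarrow> \<bar>defect_form t S n L q x\<bar> \<le> K * N x" by auto
  have "\<bar>defect_form t S n (i # L) q x\<bar> \<le> (K + \<bar>t\<bar> * K) * N x" if x: "x \<in> V" for x
  proof -
    have "\<bar>t * pull (S i) (n i) (defect_form t S n L q) x\<bar> \<le> \<bar>t\<bar> * (K * N x)"
      unfolding abs_mult using pull_bound'[OF K(2,1) _ x] Cons.prems by (intro mult_left_mono) auto
    then show ?thesis
      using K(2)[OF x] abs_triangle_ineq4[of "defect_form t S n L q x"
          "t * pull (S i) (n i) (defect_form t S n L q) x"]
      by (simp add: distrib_right mult.assoc)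
  qed
  then show ?case using K(1) by (intro exI[of _ "K + \<bar>t\<bar> * K"]) auto
qed

text \<open>One factor is shrunk at a time.  Commutation moves the factor of \<open>i\<close> to the front, so that
  \<open>A - \<Phi>\<^sub>i A \<ge> d N\<close> for the product \<open>A\<close> of the factors that are already shrunk.  Then \<open>A \<ge> 0\<close> by
  \<open>inverse_positive\<close>, and \<open>A - t \<Phi>\<^sub>i A = (A - \<Phi>\<^sub>i A) + (1 - t) \<Phi>\<^sub>i A \<ge> d N\<close>.\<close>

lemma defect_form_shrink:
  assumes "distinct L" "set L \<subseteq> {..<k}" and t: "0 \<le> t" "t \<le> 1" and d: "d \<ge> 0"
    and "\<And>x. x \<in> V \<Longrightarrow> \<bar>q x\<bar> \<le> M * N x" "M \<ge> 0"
    and "\<And>x. x \<in> V \<Longrightarrow> d * N x \<le> defect_form 1 S n L q x"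
    and "x \<in> V"
  shows "d * N x \<le> defect_form t S n L q x"
  using assms(1,2,6-)
proof (induction L arbitrary: q M x)
  case Nil
  then show ?case by simp
next
  case (Cons i L)
  have i: "i < k" "i \<notin> set L" and L: "set L \<subseteq> {..<k}" "distinct L" using Cons.prems by auto
  let ?q = "\<lambda>x. q x - 1 * pull (S i) (n i) q x"
  let ?A = "defect_form t S n L q"
  have "\<bar>?q x\<bar> \<le> (M + M) * N x" if "x \<in> V" for x
    using Cons.prems(3)[OF that] pull_bound'[OF Cons.prems(3,4) i(1) that]
    by (simp add: algebra_simps abs_if split: if_splits)
  moreover have "d * N x \<le> defect_form 1 S n L ?q x" if "x \<in> V" for x
    using Cons.prems(5)[OF that] defect_form_pull[OF L(1) i that, of 1 q 1] by simp
  ultimately have E: "d * N x \<le> defect_form t S n L ?q x" if "x \<in> V" for x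
    using Cons.IH[of ?q "M + M"] L Cons.prems(4) that by simp
  have A: "d * N x \<le> ?A x - pull (S i) (n i) ?A x" if "x \<in> V" for x
    using E[OF that] defect_form_pull[OF L(1) i that, of t q 1] by linarith
  obtain K where K: "K \<ge> 0" "\<And>x. x \<in> V \<Longrightarrow> \<bar>?A x\<bar> \<le> K * N x"
    using defect_form_bounded[OF L(1) Cons.prems(3,4)] by blast
  have "0 \<le> ?A x" if "x \<in> V" for x
  proof (rule inverse_positive[OF i(1) K(2,1) _ that])
    fix y assume y: "y \<in> V"
    then show "pull (S i) (n i) ?A y \<le> ?A y"
      using A[OF y] mult_nonneg_nonneg[OF d N_nonneg[OF y]] by linarith
  qed
  then have "0 \<le> (1 - t) * pull (S i) (n i) ?A x"
    using pull_nonneg[of ?A i x] i Cons.prems t by simp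
  then show ?case using A[OF Cons.prems(6)] by (simp add: algebra_simps)
qed

text \<open>A Lipschitz estimate in the dilation parameter, uniform on the unit sphere of \<open>N\<close>; it makes the
  polyball open along rays.\<close>

lemma defect_form_continuous:
  assumes "set L \<subseteq> {..<k}" and q: "\<And>x. x \<in> V \<Longrightarrow> \<bar>q x\<bar> \<le> M * N x" and M: "M \<ge> 0"
  shows "\<exists>K\<ge>0. \<forall>t. 1 \<le> t \<longrightarrow> t \<le> 2 \<longrightarrow>
    (\<forall>x\<in>V. \<bar>defect_form t S n L q x - defect_form 1 S n L q x\<bar> \<le> (t - 1) * K * N x)"
  using assms(1)
proof (induction L)
  case Nil
  then show ?case by auto
next
  case (Cons i L)
  let ?E = "\<lambda>t x. defect_form t S n L q x - defect_form 1 S n L q x"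
  obtain K where K: "K \<ge> 0" "\<And>t x. 1 \<le> t \<Longrightarrow> t \<le> 2 \<Longrightarrow> x \<in> V \<Longrightarrow> \<bar>?E t x\<bar> \<le> (t - 1) * K * N x"
    using Cons by auto
  obtain B where B: "B \<ge> 0" "\<And>x. x \<in> V \<Longrightarrow> \<bar>defect_form 1 S n L q x\<bar> \<le> B * N x"
    using defect_form_bounded[OF _ q M, of L 1] Cons.prems by auto
  have i: "i < k" using Cons.prems by simp
  have "\<bar>defect_form t S n (i # L) q x - defect_form 1 S n (i # L) q x\<bar> \<le> (t - 1) * (K + 2 * K + B) * N x"
    if t: "1 \<le> t" "t \<le> 2" and x: "x \<in> V" for t x
  proof -
    let ?P = "pull (S i) (n i)"
    have "0 \<le> (t - 1) * K" using t K(1) by simp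
    from pull_bound'[OF K(2)[OF t] this i x]
    have "\<bar>?P (?E t) x\<bar> \<le> (t - 1) * K * N x" .
    then have "t * \<bar>?P (?E t) x\<bar> \<le> 2 * ((t - 1) * K * N x)"
      using t by (intro mult_mono) auto
    moreover have "(t - 1) * \<bar>?P (defect_form 1 S n L q) x\<bar> \<le> (t - 1) * (B * N x)"
      using t pull_bound'[OF B(2,1) i x] by (intro mult_left_mono) auto
    moreover have "defect_form t S n (i # L) q x - defect_form 1 S n (i # L) q x
        = ?E t x - t * ?P (?E t) x - (t - 1) * ?P (defect_form 1 S n L q) x"
      by (simp add: pull_def sum_subtractf algebra_simps)
    moreover have "\<bar>?E t x - t * ?P (?E t) x - (t - 1) * ?P (defect_form 1 S n L q) x\<bar>
        \<le> \<bar>?E t x\<bar> + t * \<bar>?P (?E t) x\<bar> + (t - 1) * \<bar>?P (defect_form 1 S n L q) x\<bar>"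
      using t abs_triangle_ineq4[of "?E t x - t * ?P (?E t) x" "(t - 1) * ?P (defect_form 1 S n L q) x"]
        abs_triangle_ineq4[of "?E t x" "t * ?P (?E t) x"] by (simp add: abs_mult)
    ultimately show ?thesis using K(2)[OF t x] by (simp add: algebra_simps)
  qed
  then show ?case using K(1) B(1) by (intro exI[of _ "K + 2 * K + B"]) auto
qed

end

text \<open>With \<open>D\<^sub>m\<close> the defect over \<open>m\<close> factors, \<open>0 \<le> D\<^sub>m \<le> N\<close> gives \<open>0 \<le> \<Phi> D\<^sub>m \<le> \<Phi> N\<close> for the next
  factor, so that both bounds pass from \<open>D\<^sub>m\<close> to \<open>D\<^sub>m - \<Phi> D\<^sub>m\<close>.  Positivity of \<open>D\<^sub>m\<close> comes from the lower
  bound itself.\<close>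

lemma defect_form_lower_bound:
  fixes V :: "'a set" and N :: "'a \<Rightarrow> real"
  assumes S_in: "\<And>i j x. i \<in> set L \<Longrightarrow> j < n i \<Longrightarrow> x \<in> V \<Longrightarrow> S i j x \<in> V"
    and N: "\<And>x. x \<in> V \<Longrightarrow> 0 \<le> N x"
    and sub: "\<And>x. x \<in> V \<Longrightarrow> (\<Sum>i\<leftarrow>L. pull (S i) (n i) N x) \<le> N x"
    and x: "x \<in> V"
  shows "N x - (\<Sum>i\<leftarrow>L. pull (S i) (n i) N x) \<le> defect_form 1 S n L N x
    \<and> defect_form 1 S n L N x \<le> N x"
  using assms
proof (induction L arbitrary: x)
  case (Cons i L)
  let ?D = "defect_form 1 S n L N"
  have pull_N: "0 \<le> pull (S i) (n i) N x" if "x \<in> V" for x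
    unfolding pull_def using Cons.prems(1,2) that by (intro sum_nonneg) auto
  have sub: "(\<Sum>i\<leftarrow>L. pull (S i) (n i) N x) \<le> N x" if "x \<in> V" for x
    using Cons.prems(3)[OF that] pull_N[OF that] by simp
  have D: "N x - (\<Sum>i\<leftarrow>L. pull (S i) (n i) N x) \<le> ?D x \<and> ?D x \<le> N x" if "x \<in> V" for x
    using Cons.IH[OF _ _ sub that] Cons.prems(1,2) by simp
  have "0 \<le> ?D x" if "x \<in> V" for x using D[OF that] sub[OF that] by linarith
  then have "0 \<le> pull (S i) (n i) ?D x" "pull (S i) (n i) ?D x \<le> pull (S i) (n i) N x"
    unfolding pull_def using Cons.prems(1,4) D by (auto intro!: sum_nonneg sum_mono)
  then show ?case using D[OF Cons.prems(4)] by simp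
qed simp

context complex_hilbert_space
begin

abbreviation nsq :: "'a \<Rightarrow> real" where "nsq \<equiv> \<lambda>x. (nrm x)\<^sup>2"

section \<open>Coercive operators\<close>

text \<open>Surjectivity is \<open>coercive_representation\<close> for the functional \<open>x \<mapsto> \<langle>x, y\<rangle>\<close>; injectivity and
  boundedness of the inverse follow from \<open>d \<parallel>x\<parallel> \<le> \<parallel>A x\<parallel>\<close>.\<close>

lemma coercive_imp_invertible:
  assumes A: "A \<in> bounded_ops H"
    and sym: "\<And>x y. x \<in> V \<Longrightarrow> y \<in> V \<Longrightarrow> ip (A x) y = ip x (A y)"
    and d: "d > 0" and coercive: "\<And>x. x \<in> V \<Longrightarrow> d * nsq x \<le> Re (ip (A x) x)"
  shows "invertible_op H A"
proof -
  note A_in = bop_in[OF A]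
  have surj: "\<exists>z\<in>V. A z = y" if y: "y \<in> V" for y
  proof -
    obtain z where z: "z \<in> V" "\<And>x. x \<in> V \<Longrightarrow> ip x y = ip (A x) z"
    proof (rule coercive_representation[OF A sym d coercive, of "\<lambda>x. ip x y" "nrm y"])
      fix x assume "x \<in> V"
      then show "cmod (ip x y) \<le> nrm y * nrm x"
        using ip_cauchy_schwarz[of x y] y by (simp add: mult.commute)
    qed (use y in \<open>auto simp: ip_lin\<close>)
    then have "A z = y" using A_in y by (intro ip_eqI') (auto simp: sym)
    then show ?thesis using z(1) by blast
  qed
  have lower: "d * nrm x \<le> nrm (A x)" if x: "x \<in> V" for x
  proof -
    have "d * nsq x \<le> nrm (A x) * nrm x"
      using coercive[OF x] ip_cauchy_schwarz[OF A_in[OF x] x] complex_Re_le_cmod[of "ip (A x) x"]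
      by linarith
    then have "d * nrm x * nrm x \<le> nrm (A x) * nrm x" by (simp add: power2_eq_square mult.assoc)
    then show ?thesis
      using x A_in[OF x] nrm_nonneg[OF x] mult_right_le_imp_le[of "d * nrm x" "nrm x" "nrm (A x)"]
      by (cases "nrm x = 0") auto
  qed
  have inj: "x = y" if xy: "x \<in> V" "y \<in> V" "A x = A y" for x y
  proof -
    have "A (x \<ominus>\<^bsub>H\<^esub> y) = \<zero>\<^bsub>H\<^esub>"
      using xy A_in by (intro ip_eqI) (auto simp: diff_eq bop_add[OF A] bop_smult[OF A] ip_lin)
    then have "nrm (x \<ominus>\<^bsub>H\<^esub> y) \<le> 0"
      using lower[of "x \<ominus>\<^bsub>H\<^esub> y"] xy d by (simp add: mult_le_0_iff)
    then have "nrm (x \<ominus>\<^bsub>H\<^esub> y) = 0" using xy by (intro antisym) auto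
    then have "x \<ominus>\<^bsub>H\<^esub> y = \<zero>\<^bsub>H\<^esub>" using xy nrm_eq_0 by simp
    then show ?thesis using xy ip_diff_left[of x y] by (intro ip_eqI) auto
  qed
  define S where "S = (\<lambda>y\<in>V. inv_into V A y)"
  have S: "S y \<in> V" "A (S y) = y" if "y \<in> V" for y
    using surj[OF that] that f_inv_into_f[of y A V] inv_into_into[of y A V]
    by (auto simp: S_def)
  have "S \<in> bounded_ops H"
  proof (rule bounded_opsI[where C = "1 / d"])
    fix x z assume xz: "x \<in> V" "z \<in> V"
    have "nrm (S x) \<le> 1 / d * nrm x" using lower[OF S(1)] S(2) xz d by (simp add: field_simps)
    then have "nrm (S x) * nrm z \<le> 1 / d * nrm x * nrm z"
      using xz by (intro mult_right_mono) auto
    then show "cmod (ip (S x) z) \<le> 1 / d * nrm x * nrm z"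
      using ip_cauchy_schwarz[OF S(1) xz(2)] xz by (meson order_trans)
  next
    fix x y z assume xyz: "x \<in> V" "y \<in> V" "z \<in> V"
    then have "S (x \<oplus>\<^bsub>H\<^esub> y) = S x \<oplus>\<^bsub>H\<^esub> S y" using inj by (simp add: S bop_add[OF A])
    then show "ip (S (x \<oplus>\<^bsub>H\<^esub> y)) z = ip (S x) z + ip (S y) z" using xyz S by (simp add: ip_lin)
  next
    fix c x z assume xz: "x \<in> V" "z \<in> V"
    then have "S (c \<odot>\<^bsub>H\<^esub> x) = c \<odot>\<^bsub>H\<^esub> S x" using inj by (simp add: S bop_smult[OF A])
    then show "ip (S (c \<odot>\<^bsub>H\<^esub> x)) z = c * ip (S x) z" using xz S by (simp add: ip_lin)
  qed (auto simp: S, auto simp: S_def)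
  moreover have "op_mult H S A = op_id H" "op_mult H A S = op_id H"
    using S inj A_in by (auto simp: op_mult_def compose_def op_id_def fun_eq_iff)
  ultimately show ?thesis unfolding invertible_op_def by blast
qed

text \<open>A positive operator with \<open>\<parallel>A\<parallel> \<le> M\<close> satisfies \<open>\<parallel>A x\<parallel>\<^sup>2 \<le> M \<langle>A x, x\<rangle>\<close>; if it is invertible, then
  \<open>\<parallel>x\<parallel> \<le> C \<parallel>A x\<parallel>\<close>, and the two estimates combine to a lower bound of its form.\<close>

lemma positive_invertible_iff_coercive:
  assumes A: "A \<in> bounded_ops H"
    and sym: "\<And>x y. x \<in> V \<Longrightarrow> y \<in> V \<Longrightarrow> ip (A x) y = ip x (A y)"
  shows "positive_op H A \<and> invertible_op H A \<longleftrightarrow>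
    (\<exists>d>0. \<forall>x\<in>V. d * nsq x \<le> Re (ip (A x) x))"
proof
  note A_in = bop_in[OF A]
  assume "positive_op H A \<and> invertible_op H A"
  then obtain S where pos: "\<And>x. x \<in> V \<Longrightarrow> 0 \<le> Re (ip (A x) x)"
    and S: "S \<in> bounded_ops H" "op_mult H S A = op_id H"
    by (auto simp: positive_op_def invertible_op_def)
  obtain M where M: "M > 0" "\<And>x. x \<in> V \<Longrightarrow> nrm (A x) \<le> M * nrm x" using bop_bound[OF A] by blast
  obtain C where C: "C > 0" "\<And>x. x \<in> V \<Longrightarrow> nrm (S x) \<le> C * nrm x" using bop_bound[OF S(1)] by blast
  have "1 / (C\<^sup>2 * M) * nsq x \<le> Re (ip (A x) x)" if x: "x \<in> V" for x
  proof -
    \<comment> \<open>Positivity at the point \<open>w = x - A x / M\<close> gives \<open>\<parallel>A x\<parallel>\<^sup>2 \<le> M \<langle>A x, x\<rangle>\<close>.\<close>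
    define w where "w = x \<ominus>\<^bsub>H\<^esub> of_real (1 / M) \<odot>\<^bsub>H\<^esub> A x"
    have w: "w \<in> V" using x A_in by (simp add: w_def)
    have "ip (A w) w = ip (A x) x - 2 * (of_real (1 / M) * ip (A x) (A x))
        + of_real ((1 / M)\<^sup>2) * ip (A (A x)) (A x)"
      using x A_in sym[of "A x" x]
      by (simp add: w_def diff_eq bop_add[OF A] bop_smult[OF A] ip_lin algebra_simps power2_eq_square)
    then have "Re (ip (A w) w) = Re (ip (A x) x) - 2 / M * nsq (A x) + (1 / M)\<^sup>2 * Re (ip (A (A x)) (A x))"
      using x A_in by (simp add: ip_self)
    moreover have "Re (ip (A (A x)) (A x)) \<le> M * nsq (A x)"
      using bop_ip_bound[OF A M(2), of "A x" "A x"] complex_Re_le_cmod[of "ip (A (A x)) (A x)"] A_in x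
      by (simp add: power2_eq_square mult.assoc)
    then have "(1 / M)\<^sup>2 * Re (ip (A (A x)) (A x)) \<le> (1 / M)\<^sup>2 * (M * nsq (A x))"
      by (intro mult_left_mono) auto
    ultimately have "2 / M * nsq (A x) \<le> Re (ip (A x) x) + (1 / M)\<^sup>2 * (M * nsq (A x))"
      using pos[OF w] by linarith
    also have "(1 / M)\<^sup>2 * (M * nsq (A x)) = 1 / M * nsq (A x)"
      using M(1) by (simp add: power2_eq_square)
    finally have le: "1 / M * nsq (A x) \<le> Re (ip (A x) x)" by simp
    have "x = S (A x)" using fun_cong[OF S(2), of x] x by (simp add: op_mult_apply op_id_apply)
    then have "nrm x \<le> C * nrm (A x)" using C(2)[OF A_in[OF x]] by simp
    then have "nsq x \<le> C\<^sup>2 * nsq (A x)"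
      using x power_mono[of "nrm x" "C * nrm (A x)" 2] by (simp add: power_mult_distrib)
    then have "nsq x / (C\<^sup>2 * M) \<le> (C\<^sup>2 * nsq (A x)) / (C\<^sup>2 * M)"
      using M C by (intro divide_right_mono) auto
    then show ?thesis using le C(1) by simp
  qed
  then show "\<exists>d>0. \<forall>x\<in>V. d * nsq x \<le> Re (ip (A x) x)"
    using C(1) M(1) by (intro exI[of _ "1 / (C\<^sup>2 * M)"]) auto
next
  assume "\<exists>d>0. \<forall>x\<in>V. d * nsq x \<le> Re (ip (A x) x)"
  then obtain d where d: "d > 0" "\<And>x. x \<in> V \<Longrightarrow> d * nsq x \<le> Re (ip (A x) x)" by blast
  have "0 \<le> Re (ip (A x) x) \<and> Im (ip (A x) x) = 0" if x: "x \<in> V" for x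
  proof
    have "0 \<le> d * nsq x" using d(1) by simp
    then show "0 \<le> Re (ip (A x) x)" using d(2)[OF x] by linarith
    show "Im (ip (A x) x) = 0"
      using sym[OF x x] cinner_commute[OF x bop_in[OF A x]] by (simp add: complex_eq_iff)
  qed
  then show "positive_op H A \<and> invertible_op H A"
    using A coercive_imp_invertible[OF A sym d] by (auto simp: positive_op_def)
qed

section \<open>Row operators\<close>

lemma ip_row:
  assumes A: "finite A" and f: "\<And>i. i \<in> A \<Longrightarrow> f i \<in> bounded_ops H" and xy: "x \<in> V" "y \<in> V"
  shows "ip (op_sum H (\<lambda>i. op_mult H (f i) (adj H (f i))) A x) y
    = (\<Sum>i\<in>A. ip (adj H (f i) x) (adj H (f i) y))"
proof -
  have "op_mult H (f i) (adj H (f i)) x \<in> V" if "i \<in> A" for i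
    using bop_in[OF bop_mult[OF f bop_adj[OF f]]] that xy by blast
  then show ?thesis
    using A xy by (subst ip_op_sum) (auto intro!: sum.cong simp: op_mult_apply adj_eq f adj_in)
qed

lemma row_bop:
  assumes "finite A" and f: "\<And>i. i \<in> A \<Longrightarrow> f i \<in> bounded_ops H"
  shows "op_sum H (\<lambda>i. op_mult H (f i) (adj H (f i))) A \<in> bounded_ops H"
  using assms by (intro bop_sum) auto

text \<open>The norm of the positive operator \<open>\<Sum>\<^sub>i f\<^sub>i f\<^sub>i\<^sup>*\<close> is the bound of its quadratic form: the converse
  estimate is \<open>row_op_norm_ge\<close>.  Together they let every row norm be handled through the vectors
  \<open>f\<^sub>i\<^sup>* x\<close>.\<close>

lemma row_op_norm_le:
  assumes A: "finite A" and f: "\<And>i. i \<in> A \<Longrightarrow> f i \<in> bounded_ops H" and C: "C \<ge> 0"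
    and le: "\<And>x. x \<in> V \<Longrightarrow> (\<Sum>i\<in>A. nsq (adj H (f i) x)) \<le> C * nsq x"
  shows "op_norm H (op_sum H (\<lambda>i. op_mult H (f i) (adj H (f i))) A) \<le> C"
proof (rule op_norm_le[OF C])
  fix x assume x: "x \<in> V"
  let ?R = "op_sum H (\<lambda>i. op_mult H (f i) (adj H (f i))) A"
  have Rx: "?R x \<in> V" using bop_in[OF row_bop[where f = f, OF A f]] x by blast
  have root: "sqrt (\<Sum>i\<in>A. nsq (adj H (f i) y)) \<le> sqrt C * nrm y" if y: "y \<in> V" for y
    using real_sqrt_le_mono[OF le[OF y]] y by (simp add: real_sqrt_mult)
  have "cmod (ip (?R x) (?R x)) \<le> (\<Sum>i\<in>A. nrm (adj H (f i) x) * nrm (adj H (f i) (?R x)))"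
  proof -
    have "ip (?R x) (?R x) = (\<Sum>i\<in>A. ip (adj H (f i) x) (adj H (f i) (?R x)))"
      by (rule ip_row) (use A f x Rx in auto)
    then show ?thesis
      using x Rx adj_in[OF f] by (auto intro!: order_trans[OF norm_sum] sum_mono ip_cauchy_schwarz)
  qed
  also have "\<dots> \<le> (\<Sum>i\<in>A. \<bar>nrm (adj H (f i) x)\<bar> * \<bar>nrm (adj H (f i) (?R x))\<bar>)"
    by (intro sum_mono) (simp add: abs_mult[symmetric])
  also have "\<dots> \<le> sqrt (\<Sum>i\<in>A. nsq (adj H (f i) x)) * sqrt (\<Sum>i\<in>A. nsq (adj H (f i) (?R x)))"
    using L2_set_mult_ineq[of "\<lambda>i. nrm (adj H (f i) x)" "\<lambda>i. nrm (adj H (f i) (?R x))" A]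
    by (simp add: L2_set_def)
  also have "\<dots> \<le> (sqrt C * nrm x) * (sqrt C * nrm (?R x))"
    using root[OF x] root[OF Rx] C x by (intro mult_mono) (auto intro: sum_nonneg)
  also have "\<dots> = C * nrm x * nrm (?R x)" using C by simp
  finally show "nrm (?R x) \<le> C * nrm x" using Rx C x by (intro nrm_le_if_ip_le) auto
qed

lemma row_op_norm_ge:
  assumes A: "finite A" and f: "\<And>i. i \<in> A \<Longrightarrow> f i \<in> bounded_ops H" and x: "x \<in> V"
  shows "(\<Sum>i\<in>A. nsq (adj H (f i) x)) \<le> op_norm H (op_sum H (\<lambda>i. op_mult H (f i) (adj H (f i))) A) * nsq x"
proof -
  let ?R = "op_sum H (\<lambda>i. op_mult H (f i) (adj H (f i))) A"
  have "ip (?R x) x = (\<Sum>i\<in>A. of_real (nsq (adj H (f i) x)))"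
  proof -
    have "ip (?R x) x = (\<Sum>i\<in>A. ip (adj H (f i) x) (adj H (f i) x))"
      by (rule ip_row) (use A f x in auto)
    then show ?thesis using adj_in[OF f] x by (simp add: ip_self)
  qed
  then have "(\<Sum>i\<in>A. nsq (adj H (f i) x)) = Re (ip (?R x) x)" by simp
  also have "\<dots> \<le> op_norm H ?R * nrm x * nrm x"
    using ip_le_op_norm[OF row_bop[where f = f, OF A f] x x] complex_Re_le_cmod[of "ip (?R x) x"] by linarith
  finally show ?thesis by (simp add: power2_eq_square mult.assoc)
qed

section \<open>The polyball through quadratic forms\<close>

text \<open>Stated for an arbitrary list of indices because the defect is a fold.  Self-adjointness is part of
  the induction: it makes the operator accessible to \<open>positive_invertible_iff_coercive\<close>.\<close>

lemma defect_operator_form: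
  assumes "\<And>i j. i \<in> set L \<Longrightarrow> j < n i \<Longrightarrow> X i j \<in> bounded_ops H"
  defines "D \<equiv> foldr (\<lambda>i Y. op_diff H Y (Phi H (n i) (X i) Y)) L (op_id H)"
  shows "D \<in> bounded_ops H \<and> (\<forall>x\<in>V. \<forall>y\<in>V. ip (D x) y = ip x (D y)) \<and>
    (\<forall>x\<in>V. Re (ip (D x) x) = defect_form 1 (\<lambda>i j. adj H (X i j)) n L nsq x)"
  using assms(1) unfolding D_def
proof (induction L)
  case Nil
  then show ?case by (auto simp: op_id_apply nrm_sq)
next
  case (Cons i L)
  let ?D = "foldr (\<lambda>i Y. op_diff H Y (Phi H (n i) (X i) Y)) L (op_id H)"
  let ?P = "Phi H (n i) (X i) ?D"
  have D: "?D \<in> bounded_ops H" and sym: "\<And>x y. x \<in> V \<Longrightarrow> y \<in> V \<Longrightarrow> ip (?D x) y = ip x (?D y)"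
    and form: "\<And>x. x \<in> V \<Longrightarrow> Re (ip (?D x) x) = defect_form 1 (\<lambda>i j. adj H (X i j)) n L nsq x"
    using Cons by auto
  have X: "X i j \<in> bounded_ops H" if "j < n i" for j using Cons.prems that by auto
  have summand: "op_mult H (X i j) (op_mult H ?D (adj H (X i j))) \<in> bounded_ops H" if "j < n i" for j
    using X[OF that] D by blast
  have P_def: "?P = op_sum H (\<lambda>j. op_mult H (X i j) (op_mult H ?D (adj H (X i j)))) {..<n i}"
    by (rule Phi_def)
  have P: "?P \<in> bounded_ops H" unfolding P_def using summand by (intro bop_sum) auto
  have ipP: "ip (?P x) y = (\<Sum>j<n i. ip (?D (adj H (X i j) x)) (adj H (X i j) y))"
    if "x \<in> V" "y \<in> V" for x y
    unfolding P_def using that bop_in[OF summand]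
    by (subst ip_op_sum)
      (auto intro!: sum.cong simp: op_mult_apply adj_in[OF X] adj_eq[OF X] bop_in[OF D])
  have ipP': "ip y (?P x) = (\<Sum>j<n i. ip (adj H (X i j) y) (?D (adj H (X i j) x)))"
    if "x \<in> V" "y \<in> V" for x y
  proof -
    have "ip y (?P x) = cnj (ip (?P x) y)" using that bop_in[OF P] by (intro cinner_commute)
    also have "\<dots> = (\<Sum>j<n i. cnj (ip (?D (adj H (X i j) x)) (adj H (X i j) y)))"
      using that by (simp add: ipP)
    also have "\<dots> = (\<Sum>j<n i. ip (adj H (X i j) y) (?D (adj H (X i j) x)))"
      using that by (intro sum.cong refl cinner_commute[symmetric]) (auto simp: adj_in[OF X] bop_in[OF D])
    finally show ?thesis .
  qed
  have "op_diff H ?D ?P \<in> bounded_ops H" using D P by blast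
  moreover have "ip (op_diff H ?D ?P x) y = ip x (op_diff H ?D ?P y)" if "x \<in> V" "y \<in> V" for x y
    using that by (simp add: op_diff_apply ip_lin bop_in[OF D] bop_in[OF P] ipP ipP' sym adj_in[OF X])
  moreover have "Re (ip (op_diff H ?D ?P x) x) =
      defect_form 1 (\<lambda>i j. adj H (X i j)) n (i # L) nsq x" if "x \<in> V" for x
    using that by (simp add: op_diff_apply ip_lin bop_in[OF D] bop_in[OF P] ipP form pull_def
        adj_in[OF X])
  ultimately show ?case by simp
qed

text \<open>The condition \<open>\<Phi>\<^sub>i(I) \<le> c I\<close>, with one constant for all \<open>i < k\<close>.\<close>

definition strict_rows :: "nat \<Rightarrow> (nat \<Rightarrow> nat) \<Rightarrow> 'a op_tuple \<Rightarrow> real \<Rightarrow> bool" where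
  "strict_rows k n X c \<longleftrightarrow>
     (\<forall>i<k. \<forall>x\<in>V. pull (\<lambda>j. adj H (X i j)) (n i) nsq x \<le> c * nsq x)"

text \<open>The operator inequalities in the definition of the polyball become pointwise inequalities between
  real functions on \<open>H\<close>, so that everything below about the shape of the polyball takes place in the
  ordered vector space of such functions.\<close>

lemma polyball_iff:
  "X \<in> polyball H k n \<longleftrightarrow> X \<in> commuting_tuples H k n \<and>
     (\<exists>c\<ge>0. c < 1 \<and> strict_rows k n X c) \<and>
     (\<exists>d>0. \<forall>x\<in>V. d * nsq x \<le> defect_form 1 (\<lambda>i j. adj H (X i j)) n [0..<k] nsq x)"
proof (cases "X \<in> commuting_tuples H k n")
  case True
  then have X: "X i j \<in> bounded_ops H" if "i < k" "j < n i" for i j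
    using that by (auto simp: commuting_tuples_def)
  let ?o = "\<lambda>i. op_norm H (op_sum H (\<lambda>j. op_mult H (X i j) (adj H (X i j))) {..<n i})"
  have "(\<forall>i<k. ?o i < 1) \<longleftrightarrow> (\<exists>c\<ge>0. c < 1 \<and> strict_rows k n X c)"
  proof
    assume o: "\<forall>i<k. ?o i < 1"
    define c where "c = Max (insert 0 (?o ` {..<k}))"
    have "c \<ge> 0" by (simp add: c_def)
    moreover have "c < 1" using o by (auto simp: c_def)
    moreover have "strict_rows k n X c"
      unfolding strict_rows_def pull_def
    proof (intro allI impI ballI)
      fix i x assume i: "i < k" and x: "x \<in> V"
      have "(\<Sum>j<n i. nsq (adj H (X i j) x)) \<le> ?o i * nsq x"
        using X i x by (intro row_op_norm_ge) auto
      also have "\<dots> \<le> c * nsq x" using i by (intro mult_right_mono) (auto simp: c_def)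
      finally show "(\<Sum>j<n i. nsq (adj H (X i j) x)) \<le> c * nsq x" .
    qed
    ultimately show "\<exists>c\<ge>0. c < 1 \<and> strict_rows k n X c" by blast
  next
    assume "\<exists>c\<ge>0. c < 1 \<and> strict_rows k n X c"
    then obtain c where c: "c \<ge> 0" "c < 1" "strict_rows k n X c" by blast
    then have "?o i \<le> c" if "i < k" for i
      using X that by (intro row_op_norm_le) (auto simp: strict_rows_def pull_def)
    then show "\<forall>i<k. ?o i < 1" using c(2) by force
  qed
  moreover have "positive_op H (Defect H k n X (op_id H)) \<and> invertible_op H (Defect H k n X (op_id H))
    \<longleftrightarrow> (\<exists>d>0. \<forall>x\<in>V. d * nsq x \<le> defect_form 1 (\<lambda>i j. adj H (X i j)) n [0..<k] nsq x)"
  proof -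
    let ?D = "Defect H k n X (op_id H)"
    have D: "?D \<in> bounded_ops H" "\<And>x y. x \<in> V \<Longrightarrow> y \<in> V \<Longrightarrow> ip (?D x) y = ip x (?D y)"
      "\<And>x. x \<in> V \<Longrightarrow> Re (ip (?D x) x) = defect_form 1 (\<lambda>i j. adj H (X i j)) n [0..<k] nsq x"
      using defect_operator_form[of "[0..<k]" n X] X by (auto simp: Defect_def)
    show ?thesis using positive_invertible_iff_coercive[OF D(1,2)] D(3) by simp
  qed
  ultimately show ?thesis using True by (simp add: polyball_def)
qed (simp add: polyball_def)

end

section \<open>Dilations of the polyball\<close>

definition scale_tuple :: "'a cinner_module \<Rightarrow> complex \<Rightarrow> 'a op_tuple \<Rightarrow> 'a op_tuple" where
  "scale_tuple H z X = (\<lambda>i j. op_scale H z (X i j))"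

context complex_hilbert_space
begin

lemma adj_scale:
  assumes T: "T \<in> bounded_ops H" and x: "x \<in> V"
  shows "adj H (op_scale H z T) x = cnj z \<odot>\<^bsub>H\<^esub> adj H T x"
proof (rule ip_eqI')
  fix y assume y: "y \<in> V"
  have "ip y (adj H (op_scale H z T) x) = ip (op_scale H z T y) x"
    using adj_eq[OF bop_scale[OF T] x y] by simp
  then show "ip y (adj H (op_scale H z T) x) = ip y (cnj z \<odot>\<^bsub>H\<^esub> adj H T x)"
    using x y T bop_in[OF T] adj_in[OF T] by (simp add: op_scale_apply ip_lin adj_eq)
qed (use x T adj_in[OF T] adj_in[OF bop_scale[OF T]] in auto)

lemma nsq_adj_scale:
  assumes T: "T \<in> bounded_ops H" and x: "x \<in> V"
  shows "nsq (adj H (op_scale H z T) x) = (cmod z)\<^sup>2 * nsq (adj H T x)"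
  using adj_in[OF T x] by (simp add: adj_scale[OF T x] nrm_smult power_mult_distrib)

lemma adj_commute:
  assumes S: "S \<in> bounded_ops H" and T: "T \<in> bounded_ops H"
    and ST: "op_mult H S T = op_mult H T S" and x: "x \<in> V"
  shows "adj H S (adj H T x) = adj H T (adj H S x)"
proof (rule ip_eqI')
  fix y assume y: "y \<in> V"
  have "T (S y) = S (T y)" using fun_cong[OF ST, of y] y by (simp add: op_mult_apply)
  then show "ip y (adj H S (adj H T x)) = ip y (adj H T (adj H S x))"
    using x y adj_in[OF S] adj_in[OF T] bop_in[OF S] bop_in[OF T]
    by (simp add: adj_eq[OF S, symmetric] adj_eq[OF T, symmetric])
qed (use x adj_in[OF S] adj_in[OF T] in auto)

lemma op_scale_scale:
  "T \<in> bounded_ops H \<Longrightarrow> op_scale H z (op_scale H w T) = op_scale H (z * w) T"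
  using bop_in[of T] smult_assoc1[of z w] by (auto simp: op_scale_def fun_eq_iff)

lemma op_scale_one: "T \<in> bounded_ops H \<Longrightarrow> op_scale H 1 T = T"
  using bop_in[of T] bop_ext[of T] smult_one by (auto simp: op_scale_def fun_eq_iff)

lemma op_mult_scale:
  assumes "S \<in> bounded_ops H" "T \<in> bounded_ops H"
  shows "op_mult H (op_scale H z S) (op_scale H w T) = op_scale H (z * w) (op_mult H S T)"
  using assms bop_in[OF assms(1)] bop_in[OF assms(2)] bop_smult[OF assms(1)] smult_assoc1[of z w]
  by (auto simp: op_mult_def op_scale_def compose_def fun_eq_iff)

lemma commuting_tuples_bop: "X \<in> commuting_tuples H k n \<Longrightarrow> i < k \<Longrightarrow> j < n i \<Longrightarrow> X i j \<in> bounded_ops H"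
  by (auto simp: commuting_tuples_def)

lemma scale_tuple_commuting:
  assumes X: "X \<in> commuting_tuples H k n"
  shows "scale_tuple H z X \<in> commuting_tuples H k n"
proof -
  have "op_mult H (scale_tuple H z X s i) (scale_tuple H z X t j)
      = op_mult H (scale_tuple H z X t j) (scale_tuple H z X s i)"
    if "s < k" "t < k" "s \<noteq> t" "i < n s" "j < n t" for s t i j
  proof -
    have "op_mult H (X s i) (X t j) = op_mult H (X t j) (X s i)"
      using X that unfolding commuting_tuples_def by blast
    then show ?thesis
      using commuting_tuples_bop[OF X] that by (simp add: scale_tuple_def op_mult_scale)
  qed
  then show ?thesis
    using commuting_tuples_bop[OF X] by (auto simp: commuting_tuples_def scale_tuple_def)
qed

lemma defect_form_smult:
  assumes X: "\<And>i j. i \<in> set L \<Longrightarrow> j < n i \<Longrightarrow> X i j \<in> bounded_ops H" and x: "x \<in> V"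
  shows "defect_form t (\<lambda>i j. adj H (X i j)) n L nsq (z \<odot>\<^bsub>H\<^esub> x)
    = (cmod z)\<^sup>2 * defect_form t (\<lambda>i j. adj H (X i j)) n L nsq x"
  using X x
proof (induction L arbitrary: x)
  case (Cons i L)
  have "pull (\<lambda>j. adj H (X i j)) (n i) (defect_form t (\<lambda>i j. adj H (X i j)) n L nsq) (z \<odot>\<^bsub>H\<^esub> x)
    = (cmod z)\<^sup>2 * pull (\<lambda>j. adj H (X i j)) (n i) (defect_form t (\<lambda>i j. adj H (X i j)) n L nsq) x"
    unfolding pull_def sum_distrib_left
    using Cons by (intro sum.cong) (auto simp: bop_smult[OF bop_adj] adj_in)
  then show ?case using Cons by (simp add: algebra_simps)
qed (simp add: nrm_smult power_mult_distrib)

lemma defect_form_scale_tuple: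
  assumes X: "\<And>i j. i \<in> set L \<Longrightarrow> j < n i \<Longrightarrow> X i j \<in> bounded_ops H" and x: "x \<in> V"
  shows "defect_form t (\<lambda>i j. adj H (scale_tuple H z X i j)) n L nsq x
    = defect_form (t * (cmod z)\<^sup>2) (\<lambda>i j. adj H (X i j)) n L nsq x"
  using X x
proof (induction L arbitrary: x)
  case (Cons i L)
  let ?D = "defect_form t (\<lambda>i j. adj H (scale_tuple H z X i j)) n L nsq"
  let ?E = "defect_form (t * (cmod z)\<^sup>2) (\<lambda>i j. adj H (X i j)) n L nsq"
  have "?D (adj H (scale_tuple H z X i j) x) = (cmod z)\<^sup>2 * ?E (adj H (X i j) x)" if "j < n i" for j
  proof -
    have X': "X i j \<in> bounded_ops H" using Cons.prems that by auto
    have in_V: "adj H (X i j) x \<in> V" using adj_in[OF X'] Cons.prems by blast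
    have "?D (adj H (scale_tuple H z X i j) x) = ?D (cnj z \<odot>\<^bsub>H\<^esub> adj H (X i j) x)"
      using adj_scale[OF X'] Cons.prems by (simp add: scale_tuple_def)
    also have "\<dots> = ?E (cnj z \<odot>\<^bsub>H\<^esub> adj H (X i j) x)"
      using Cons.prems in_V by (intro Cons.IH) auto
    also have "\<dots> = (cmod z)\<^sup>2 * ?E (adj H (X i j) x)"
      using Cons.prems in_V by (subst defect_form_smult) auto
    finally show ?thesis .
  qed
  then have "pull (\<lambda>j. adj H (scale_tuple H z X i j)) (n i) ?D x
      = (cmod z)\<^sup>2 * pull (\<lambda>j. adj H (X i j)) (n i) ?E x"
    unfolding pull_def sum_distrib_left by (intro sum.cong) auto
  then show ?case using Cons by (simp add: mult.assoc)
qed simp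

lemma strict_rows_scale_tuple:
  assumes X: "X \<in> commuting_tuples H k n" and c: "strict_rows k n X c"
  shows "strict_rows k n (scale_tuple H z X) ((cmod z)\<^sup>2 * c)"
  unfolding strict_rows_def
proof (intro allI impI ballI)
  fix i x assume i: "i < k" and x: "x \<in> V"
  have "pull (\<lambda>j. adj H (scale_tuple H z X i j)) (n i) nsq x
      = (cmod z)\<^sup>2 * pull (\<lambda>j. adj H (X i j)) (n i) nsq x"
  proof -
    have "nsq (adj H (scale_tuple H z X i j) x) = (cmod z)\<^sup>2 * nsq (adj H (X i j) x)"
      if "j < n i" for j
      using nsq_adj_scale[OF commuting_tuples_bop[OF X i that] x] by (simp add: scale_tuple_def)
    then show ?thesis by (simp add: pull_def sum_distrib_left)
  qed
  also have "\<dots> \<le> (cmod z)\<^sup>2 * (c * nsq x)"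
    using c i x by (intro mult_left_mono) (auto simp: strict_rows_def)
  finally show "pull (\<lambda>j. adj H (scale_tuple H z X i j)) (n i) nsq x \<le> (cmod z)\<^sup>2 * c * nsq x"
    by simp
qed

lemma commuting_contractions_adj:
  assumes X: "X \<in> commuting_tuples H k n" and c: "c \<ge> 0" "c < 1" "strict_rows k n X c"
  shows "commuting_contractions V (\<lambda>i j. adj H (X i j)) n k nsq c"
proof
  fix i i' j j' x
  assume *: "i < k" "i' < k" "i \<noteq> i'" "j < n i" "j' < n i'" "x \<in> V"
  then have "op_mult H (X i j) (X i' j') = op_mult H (X i' j') (X i j)"
    using X unfolding commuting_tuples_def by blast
  then show "adj H (X i j) (adj H (X i' j') x) = adj H (X i' j') (adj H (X i j) x)"
    using * commuting_tuples_bop[OF X] by (intro adj_commute) auto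
qed (use c adj_in[OF commuting_tuples_bop[OF X]] in \<open>auto simp: strict_rows_def\<close>)

lemma polyball_balanced:
  assumes X: "X \<in> polyball H k n" and z: "cmod z \<le> 1"
  shows "scale_tuple H z X \<in> polyball H k n"
proof -
  obtain c d where C: "X \<in> commuting_tuples H k n" and cc: "c \<ge> 0" "c < 1" "strict_rows k n X c"
    and d: "d > 0" "\<And>x. x \<in> V \<Longrightarrow> d * nsq x \<le> defect_form 1 (\<lambda>i j. adj H (X i j)) n [0..<k] nsq x"
    using X unfolding polyball_iff by blast
  interpret commuting_contractions V "\<lambda>i j. adj H (X i j)" n k nsq c
    by (rule commuting_contractions_adj[OF C cc])
  have t: "(cmod z)\<^sup>2 \<le> 1" using z by (simp add: abs_square_le_1)
  have "d * nsq x \<le> defect_form 1 (\<lambda>i j. adj H (scale_tuple H z X i j)) n [0..<k] nsq x"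
    if x: "x \<in> V" for x
  proof -
    have "d * nsq x \<le> defect_form ((cmod z)\<^sup>2) (\<lambda>i j. adj H (X i j)) n [0..<k] nsq x"
      by (rule defect_form_shrink[where M = 1]) (use t d x in auto)
    then show ?thesis
      using commuting_tuples_bop[OF C] x by (subst defect_form_scale_tuple) auto
  qed
  moreover have "(cmod z)\<^sup>2 * c \<le> c" using t cc by (simp add: mult_left_le_one_le)
  then have "(cmod z)\<^sup>2 * c \<ge> 0 \<and> (cmod z)\<^sup>2 * c < 1 \<and> strict_rows k n (scale_tuple H z X) ((cmod z)\<^sup>2 * c)"
    using strict_rows_scale_tuple[OF C cc(3)] cc by auto
  ultimately show ?thesis
    unfolding polyball_iff using scale_tuple_commuting[OF C] d(1) by blast
qed

text \<open>The lower bound \<open>d\<close> of the defect form and the row bound \<open>c < 1\<close> leave room for a small dilation.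
  The factor is written as a square root because the defect depends on its square.\<close>

lemma polyball_expand:
  assumes X: "X \<in> polyball H k n"
  shows "\<exists>t>1. scale_tuple H (of_real (sqrt t)) X \<in> polyball H k n"
proof -
  obtain c d where C: "X \<in> commuting_tuples H k n" and cc: "c \<ge> 0" "c < 1" "strict_rows k n X c"
    and d: "d > 0" "\<And>x. x \<in> V \<Longrightarrow> d * nsq x \<le> defect_form 1 (\<lambda>i j. adj H (X i j)) n [0..<k] nsq x"
    using X unfolding polyball_iff by blast
  interpret commuting_contractions V "\<lambda>i j. adj H (X i j)" n k nsq c
    by (rule commuting_contractions_adj[OF C cc])
  obtain K where K: "K \<ge> 0" "\<And>t x. 1 \<le> t \<Longrightarrow> t \<le> 2 \<Longrightarrow> x \<in> V \<Longrightarrow>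
      \<bar>defect_form t (\<lambda>i j. adj H (X i j)) n [0..<k] nsq x
        - defect_form 1 (\<lambda>i j. adj H (X i j)) n [0..<k] nsq x\<bar> \<le> (t - 1) * K * nsq x"
    using defect_form_continuous[of "[0..<k]" nsq 1] by (auto simp: atLeast0LessThan)
  \<comment> \<open>The first bound keeps \<open>1 + e\<close> in the range of the Lipschitz estimate, the second gives
    \<open>(1 + e) c < 1\<close>, the third \<open>e K \<le> d / 2\<close>.\<close>
  define e where "e = min 1 (min ((1 - c) / 2) (d / (2 * (K + 1))))"
  have "0 < e" using cc d(1) K(1) by (simp add: e_def)
  moreover have "e \<le> 1" "e \<le> (1 - c) / 2" "e \<le> d / (2 * (K + 1))"
    unfolding e_def by linarith+
  ultimately have e: "0 < e" "e \<le> 1" "e \<le> (1 - c) / 2" "e \<le> d / (2 * (K + 1))" by blast+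
  have cmod: "(cmod (of_real (sqrt (1 + e))))\<^sup>2 = 1 + e" using e by simp
  have "e * K \<le> d / (2 * (K + 1)) * (K + 1)" using e K(1) by (intro mult_mono) auto
  also have "\<dots> = d / 2" using K(1) by (simp add: field_simps)
  finally have eK: "e * K \<le> d / 2" .
  have "d / 2 * nsq x
      \<le> defect_form 1 (\<lambda>i j. adj H (scale_tuple H (of_real (sqrt (1 + e))) X i j)) n [0..<k] nsq x"
    if x: "x \<in> V" for x
  proof -
    have "e * K * nsq x \<le> d / 2 * nsq x" using eK by (intro mult_right_mono) auto
    then have "d / 2 * nsq x \<le> defect_form (1 + e) (\<lambda>i j. adj H (X i j)) n [0..<k] nsq x"
      using K(2)[of "1 + e" x] d(2)[OF x] e x by simp
    then show ?thesis
      using commuting_tuples_bop[OF C] x cmod by (subst defect_form_scale_tuple) auto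
  qed
  moreover have "(1 + e) * c < 1"
  proof -
    have "e * c \<le> e * 1" using e cc by (intro mult_left_mono) auto
    then have "(1 + e) * c \<le> c + e" by (simp add: distrib_right)
    also have "c + e < 1" using e(1,3) by simp
    finally show ?thesis .
  qed
  then have "(1 + e) * c \<ge> 0 \<and> (1 + e) * c < 1
      \<and> strict_rows k n (scale_tuple H (of_real (sqrt (1 + e))) X) ((1 + e) * c)"
    using strict_rows_scale_tuple[OF C cc(3), of "of_real (sqrt (1 + e))"] cc e cmod by auto
  ultimately have "scale_tuple H (of_real (sqrt (1 + e))) X \<in> polyball H k n"
    unfolding polyball_iff using scale_tuple_commuting[OF C] d(1)
    by (meson half_gt_zero)
  then show ?thesis using e by (intro exI[of _ "1 + e"]) auto
qed

lemma sum_sigma_pull: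
  "(\<Sum>(i, j)\<in>(SIGMA i:{..<k}. {..<n i}). nsq (adj H (X i j) x))
    = (\<Sum>i\<leftarrow>[0..<k]. pull (\<lambda>j. adj H (X i j)) (n i) nsq x)"
  by (simp add: sum.Sigma[symmetric] pull_def interv_sum_list_conv_sum_set_nat atLeast0LessThan)

text \<open>If \<open>\<Sum>\<^sub>i \<Phi>\<^sub>i(I) \<le> c I\<close>, then the defect is at least \<open>I - \<Sum>\<^sub>i \<Phi>\<^sub>i(I) \<ge> (1 - c) I\<close>.\<close>

lemma row_ball_subset_polyball:
  assumes C: "X \<in> commuting_tuples H k n" and c: "0 \<le> c" "c < 1"
    and le: "\<And>x. x \<in> V \<Longrightarrow> (\<Sum>(i, j)\<in>(SIGMA i:{..<k}. {..<n i}). nsq (adj H (X i j) x)) \<le> c * nsq x"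
  shows "X \<in> polyball H k n"
proof -
  have total: "(\<Sum>i\<leftarrow>[0..<k]. pull (\<lambda>j. adj H (X i j)) (n i) nsq x) \<le> c * nsq x" if "x \<in> V" for x
    using le[OF that] by (simp only: sum_sigma_pull)
  have c_nsq: "c * nsq x \<le> nsq x" for x using c by (simp add: mult_left_le_one_le)
  have "strict_rows k n X c"
    unfolding strict_rows_def
  proof (intro allI impI ballI)
    fix i x assume i: "i < k" and x: "x \<in> V"
    have "pull (\<lambda>j. adj H (X i j)) (n i) nsq x \<le> (\<Sum>i<k. pull (\<lambda>j. adj H (X i j)) (n i) nsq x)"
      using i by (intro member_le_sum) (auto simp: pull_def intro: sum_nonneg)
    then show "pull (\<lambda>j. adj H (X i j)) (n i) nsq x \<le> c * nsq x"
      using total[OF x] by (simp add: interv_sum_list_conv_sum_set_nat atLeast0LessThan)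
  qed
  moreover have "(1 - c) * nsq x \<le> defect_form 1 (\<lambda>i j. adj H (X i j)) n [0..<k] nsq x"
    if x: "x \<in> V" for x
  proof -
    have "nsq x - (\<Sum>i\<leftarrow>[0..<k]. pull (\<lambda>j. adj H (X i j)) (n i) nsq x)
        \<le> defect_form 1 (\<lambda>i j. adj H (X i j)) n [0..<k] nsq x"
      using order_trans[OF total c_nsq] x adj_in[OF commuting_tuples_bop[OF C]]
        defect_form_lower_bound[of "[0..<k]" n V "\<lambda>i j. adj H (X i j)" nsq x] by auto
    then show ?thesis using total[OF x] by (simp add: algebra_simps)
  qed
  ultimately show ?thesis
    unfolding polyball_iff using C c by (metis diff_gt_0_iff_gt)
qed

section \<open>The Minkowski functional\<close>

lemma minkowski_le:
  assumes C: "X \<in> commuting_tuples H k n" and r: "r > 0"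
    and X: "scale_tuple H (of_real (1 / r)) X \<in> polyball H k n"
  shows "minkowski H k n X \<le> r"
  unfolding minkowski_def
proof (rule cInf_lower)
  have "X i j = op_scale H (of_real r) (scale_tuple H (of_real (1 / r)) X i j)" if "i < k" "j < n i" for i j
  proof -
    have "of_real r * of_real (1 / r) = (1 :: complex)" using r by simp
    then show ?thesis
      using commuting_tuples_bop[OF C that] unfolding scale_tuple_def
      by (simp only: op_scale_scale op_scale_one)
  qed
  then show "r \<in> {r. 0 < r \<and> (\<exists>Y\<in>polyball H k n. \<forall>i<k. \<forall>j<n i.
      X i j = op_scale H (complex_of_real r) (Y i j))}"
    using r X by blast
qed (auto intro: bdd_belowI[of _ 0])

lemma polyball_commuting: "X \<in> polyball H k n \<Longrightarrow> X \<in> commuting_tuples H k n"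
  by (simp add: polyball_def)

lemma minkowski_less_1:
  assumes X: "X \<in> polyball H k n"
  shows "minkowski H k n X < 1"
proof -
  obtain t where t: "t > 1" "scale_tuple H (of_real (sqrt t)) X \<in> polyball H k n"
    using polyball_expand[OF X] by blast
  have "minkowski H k n X \<le> 1 / sqrt t"
    using t polyball_commuting[OF X] by (intro minkowski_le) auto
  also have "\<dots> < 1" using t by simp
  finally show ?thesis .
qed

lemma minkowski_le_tuple_norm:
  assumes C: "X \<in> commuting_tuples H k n"
  shows "minkowski H k n X \<le> tuple_norm H k n X"
proof (rule dense_ge)
  fix r assume r: "tuple_norm H k n X < r"
  let ?I = "SIGMA i:{..<k}. {..<n i}"
  let ?o = "op_norm H (op_sum H (\<lambda>p. op_mult H (case p of (i, j) \<Rightarrow> X i j) (adj H (case p of (i, j) \<Rightarrow> X i j))) ?I)"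
  have X: "(case p of (i, j) \<Rightarrow> X i j) \<in> bounded_ops H" if "p \<in> ?I" for p
    using commuting_tuples_bop[OF C] that by auto
  have o: "?o \<ge> 0" using X by (intro op_norm_nonneg row_bop) auto
  have "sqrt ?o < r" using r by (simp add: tuple_norm_def row_norm_def)
  then have r0: "r > 0" using o real_sqrt_ge_zero[OF o] by linarith
  have "?o < r\<^sup>2" using \<open>sqrt ?o < r\<close> 
    using o power_strict_mono[of "sqrt ?o" r 2] by simp
  show "minkowski H k n X \<le> r"
  proof (rule minkowski_le[OF C r0], rule row_ball_subset_polyball)
    show "scale_tuple H (of_real (1 / r)) X \<in> commuting_tuples H k n"
      by (rule scale_tuple_commuting[OF C])
    show "0 \<le> ?o / r\<^sup>2" "?o / r\<^sup>2 < 1" using o r0 \<open>?o < r\<^sup>2\<close> by auto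
    fix x assume x: "x \<in> V"
    have "(\<Sum>(i, j)\<in>?I. nsq (adj H (scale_tuple H (of_real (1 / r)) X i j) x))
        = (1 / r)\<^sup>2 * (\<Sum>p\<in>?I. nsq (adj H (case p of (i, j) \<Rightarrow> X i j) x))"
      unfolding sum_distrib_left using x r0 commuting_tuples_bop[OF C]
      by (intro sum.cong) (auto simp: scale_tuple_def nsq_adj_scale norm_divide)
    also have "\<dots> \<le> (1 / r)\<^sup>2 * (?o * nsq x)"
      using X x by (intro mult_left_mono row_op_norm_ge) auto
    finally show "(\<Sum>(i, j)\<in>?I. nsq (adj H (scale_tuple H (of_real (1 / r)) X i j) x)) \<le> ?o / r\<^sup>2 * nsq x"
      by (simp add: power_divide)
  qed
qed

end

section \<open>The Schwarz lemma for graded series\<close>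

text \<open>Grouping the terms by degree \<open>d q = m\<close> turns \<open>\<phi>\<close> into a power series \<open>\<Sum>\<^sub>m C\<^sub>m z\<^sup>m\<close> on the unit disc with
  \<open>C\<^sub>0 = 0\<close>.  The first conclusion is the Schwarz lemma, the second the resulting bound of
  \<open>C\<^sub>1 = lim \<phi>(z) / z\<close>.\<close>

lemma graded_schwarz:
  fixes c :: "'i \<Rightarrow> complex" and d :: "'i \<Rightarrow> nat"
  assumes fin: "\<And>m. finite {q\<in>A. d q = m}"
    and sum: "\<And>z. cmod z < 1 \<Longrightarrow> ((\<lambda>q. z ^ d q * c q) has_sum \<phi> z) A"
    and bound: "\<And>z. cmod z < 1 \<Longrightarrow> cmod (\<phi> z) \<le> B"
    and zero: "\<phi> 0 = 0"
  shows "cmod z < 1 \<Longrightarrow> cmod (\<phi> z) \<le> B * cmod z"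
    and "cmod (\<Sum>q | q \<in> A \<and> d q = 1. c q) \<le> B"
proof -
  define C where "C m = (\<Sum>q | q \<in> A \<and> d q = m. c q)" for m
  have sums: "(\<lambda>m. C m * z ^ m) sums \<phi> z" if z: "cmod z < 1" for z
  proof -
    have "bij_betw snd (SIGMA m:UNIV. {q\<in>A. d q = m}) A"
      by (intro bij_betwI[where g = "\<lambda>q. (d q, q)"]) auto
    then have "((\<lambda>p. z ^ d (snd p) * c (snd p)) has_sum \<phi> z) (SIGMA m:UNIV. {q\<in>A. d q = m})
        \<longleftrightarrow> ((\<lambda>q. z ^ d q * c q) has_sum \<phi> z) A"
      by (rule has_sum_reindex_bij_betw)
    with sum[OF z] have S1: "((\<lambda>p. z ^ d (snd p) * c (snd p)) has_sum \<phi> z) (SIGMA m:UNIV. {q\<in>A. d q = m})"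
      by blast
    have S2: "((\<lambda>q. z ^ d q * c q) has_sum C m * z ^ m) {q\<in>A. d q = m}" for m
      using fin by (subst has_sum_finite_iff) (auto simp: C_def sum_distrib_left mult.commute)
    have "((\<lambda>m. C m * z ^ m) has_sum \<phi> z) UNIV"
      by (rule has_sum_Sigma'[OF S1]) (simp add: S2)
    then show ?thesis by (rule has_sum_imp_sums)
  qed
  have C0: "C 0 = 0"
    using sums[of 0] zero powser_sums_zero[of C] sums_unique2 by force
  have hol: "\<phi> holomorphic_on ball 0 1"
    using sums by (intro power_series_holomorphic[of 0 1 C]) auto
  have B0: "B \<ge> 0" using bound[of 0] by (auto intro: order_trans[OF norm_ge_zero])
  \<comment> \<open>The scalar Schwarz lemma assumes a strict bound, hence the detour through \<open>B' > B\<close>.\<close>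
  have less: "cmod (\<phi> z) \<le> B' * cmod z" if z: "cmod z < 1" and B': "B' > B" for z B'
  proof -
    have p: "B' > 0" using B0 B' by simp
    have "norm (\<phi> z / of_real B') \<le> norm z"
    proof (rule Schwarz_Lemma(1)[where f = "\<lambda>z. \<phi> z / of_real B'"])
      show "(\<lambda>z. \<phi> z / of_real B') holomorphic_on ball 0 1"
        using hol p by (intro holomorphic_intros) auto
      fix w :: complex assume "norm w < 1"
      then show "norm (\<phi> w / of_real B') < 1"
        using bound[of w] B' p by (simp add: norm_divide)
    qed (use zero z in auto)
    then show ?thesis using p by (simp add: norm_divide field_simps)
  qed
  have le: "cmod (\<phi> z) \<le> B * cmod z" if z: "cmod z < 1" for z
  proof (rule field_le_epsilon)
    fix e :: real assume e: "e > 0"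
    have "cmod (\<phi> z) \<le> (B + e) * cmod z" using less[OF z, of "B + e"] e by simp
    also have "\<dots> = B * cmod z + e * cmod z" by (simp add: distrib_right)
    also have "e * cmod z \<le> e * 1" using z e by (intro mult_left_mono) auto
    finally show "cmod (\<phi> z) \<le> B * cmod z + e" by simp
  qed
  then show "cmod z < 1 \<Longrightarrow> cmod (\<phi> z) \<le> B * cmod z" .
  have "((\<lambda>z. \<phi> z / z) \<longlongrightarrow> C (Suc 0)) (at 0)"
  proof (rule powser_limit_0_strong[where a = "\<lambda>m. C (Suc m)" and s = 1])
    fix z :: complex assume z: "z \<noteq> 0" "cmod z < 1"
    have "(\<lambda>m. C (Suc m) * z ^ Suc m) sums \<phi> z"
      using sums[OF z(2)] C0 by (subst sums_Suc_iff) simp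
    then have "(\<lambda>m. C (Suc m) * z ^ Suc m / z) sums (\<phi> z / z)" by (rule sums_divide)
    then show "(\<lambda>m. C (Suc m) * z ^ m) sums (\<phi> z / z)" using z by simp
  qed simp
  then have "((\<lambda>z. cmod (\<phi> z / z)) \<longlongrightarrow> cmod (C (Suc 0))) (at 0)" by (rule tendsto_norm)
  moreover have "eventually (\<lambda>z. cmod (\<phi> z / z) \<le> B) (at 0)"
    unfolding eventually_at
    using le by (intro exI[of _ 1]) (auto simp: norm_divide divide_le_eq)
  ultimately have "cmod (C (Suc 0)) \<le> B" by (intro tendsto_upperbound) auto
  then show "cmod (\<Sum>q | q \<in> A \<and> d q = 1. c q) \<le> B" by (simp add: C_def)
qed

section \<open>Formal series at a tuple\<close>

lemma finite_multiwords_of_length: "finite {\<alpha> \<in> multiwords k n. map length \<alpha> = q}"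
proof (rule finite_subset)
  let ?W = "{w. set w \<subseteq> {..<(\<Sum>i<k. n i)} \<and> length w \<le> sum_list q}"
  show "finite {\<alpha>. set \<alpha> \<subseteq> ?W \<and> length \<alpha> = k}"
    by (intro finite_lists_length_eq finite_lists_length_le) simp
  show "{\<alpha> \<in> multiwords k n. map length \<alpha> = q} \<subseteq> {\<alpha>. set \<alpha> \<subseteq> ?W \<and> length \<alpha> = k}"
  proof safe
    fix \<alpha> w assume \<alpha>: "\<alpha> \<in> multiwords k n" and w: "w \<in> set \<alpha>"
    then obtain i where i: "i < k" "w = \<alpha> ! i" "set w \<subseteq> {..<n i}"
      by (auto simp: multiwords_def in_set_conv_nth)
    have "n i \<le> (\<Sum>i<k. n i)" using i by (intro member_le_sum) auto
    then show "j \<in> set w \<Longrightarrow> j < (\<Sum>i<k. n i)" for j using i(3) by force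
    show "length w \<le> sum_list (map length \<alpha>)" using w by (auto intro: member_le_sum_list)
  qed (auto simp: multiwords_def)
qed

lemma prod_list_power: "(\<Prod>i\<leftarrow>L. z ^ f i) = z ^ (\<Sum>i\<leftarrow>L. f i)" for z :: "'a :: comm_monoid_mult"
  by (induction L) (simp_all add: power_add)

context complex_hilbert_space
begin

lemma op_prod_bop: "(\<And>T. T \<in> set Ts \<Longrightarrow> T \<in> bounded_ops H) \<Longrightarrow> op_prod H Ts \<in> bounded_ops H"
  unfolding op_prod_def by (induction Ts) auto

lemma op_prod_scale:
  assumes "\<And>i. i \<in> set L \<Longrightarrow> f i \<in> bounded_ops H"
  shows "op_prod H (map (\<lambda>i. op_scale H (c i) (f i)) L) = op_scale H (\<Prod>i\<leftarrow>L. c i) (op_prod H (map f L))"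
  using assms
proof (induction L)
  case Nil
  then show ?case by (simp add: op_prod_def op_scale_one)
next
  case (Cons i L)
  have "op_prod H (map f L) \<in> bounded_ops H" using Cons.prems by (intro op_prod_bop) auto
  then show ?case using Cons op_mult_scale[of "f i" "op_prod H (map f L)"] by (simp add: op_prod_def)
qed

definition tuple_of_ops :: "nat \<Rightarrow> (nat \<Rightarrow> nat) \<Rightarrow> 'a op_tuple \<Rightarrow> bool" where
  "tuple_of_ops k n X \<longleftrightarrow> (\<forall>i<k. \<forall>j<n i. X i j \<in> bounded_ops H)"

lemma word_bop:
  assumes "tuple_of_ops k n X" "\<alpha> \<in> multiwords k n" "i < k"
  shows "op_prod H (map (X i) (\<alpha> ! i)) \<in> bounded_ops H"
  using assms by (intro op_prod_bop) (fastforce simp: tuple_of_ops_def multiwords_def)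

lemma monomial_bop:
  assumes "tuple_of_ops k n X" "\<alpha> \<in> multiwords k n"
  shows "monomial_op H k X \<alpha> \<in> bounded_ops H"
  unfolding monomial_op_def using word_bop[OF assms] by (intro op_prod_bop) auto

lemma homogeneous_part_bop:
  assumes "tuple_of_ops k n X"
  shows "homogeneous_part H k n a X q \<in> bounded_ops H"
  unfolding homogeneous_part_def
  using monomial_bop[OF assms] by (intro bop_sum finite_multiwords_of_length) auto

lemma ip_homogeneous_part:
  assumes X: "tuple_of_ops k n X" and xy: "x \<in> V" "y \<in> V"
  shows "ip (homogeneous_part H k n a X q x) y
    = (\<Sum>\<alpha> | \<alpha> \<in> multiwords k n \<and> map length \<alpha> = q. a \<alpha> * ip (monomial_op H k X \<alpha> x) y)"
proof -
  note mono = bop_in[OF monomial_bop[OF X]]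
  have "op_scale H (a \<alpha>) (monomial_op H k X \<alpha>) x \<in> V" if "\<alpha> \<in> multiwords k n" for \<alpha>
    using mono[OF that xy(1)] xy by (simp add: op_scale_apply)
  then show ?thesis
    unfolding homogeneous_part_def using xy mono finite_multiwords_of_length[of k n q]
    by (subst ip_op_sum) (auto simp: op_scale_apply ip_lin intro!: sum.cong)
qed

lemma monomial_scale_tuple:
  assumes X: "tuple_of_ops k n X" and \<alpha>: "\<alpha> \<in> multiwords k n"
  shows "monomial_op H k (scale_tuple H z X) \<alpha>
    = op_scale H (z ^ sum_list (map length \<alpha>)) (monomial_op H k X \<alpha>)"
proof -
  have "op_prod H (map (scale_tuple H z X i) (\<alpha> ! i))
      = op_scale H (z ^ length (\<alpha> ! i)) (op_prod H (map (X i) (\<alpha> ! i)))" if i: "i < k" for i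
  proof -
    have "X i j \<in> bounded_ops H" if "j \<in> set (\<alpha> ! i)" for j
      using X \<alpha> i that unfolding tuple_of_ops_def multiwords_def by blast
    then show ?thesis
      using op_prod_scale[of "\<alpha> ! i" "X i" "\<lambda>_. z"] by (simp add: scale_tuple_def map_replicate_const)
  qed
  then have "monomial_op H k (scale_tuple H z X) \<alpha>
      = op_prod H (map (\<lambda>i. op_scale H (z ^ length (\<alpha> ! i)) (op_prod H (map (X i) (\<alpha> ! i)))) [0..<k])"
    unfolding monomial_op_def by (intro arg_cong[of _ _ "op_prod H"] map_cong) auto
  also have "\<dots> = op_scale H (\<Prod>i\<leftarrow>[0..<k]. z ^ length (\<alpha> ! i)) (monomial_op H k X \<alpha>)"
    unfolding monomial_op_def using word_bop[OF X \<alpha>] by (intro op_prod_scale) auto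
  also have "(\<Prod>i\<leftarrow>[0..<k]. z ^ length (\<alpha> ! i)) = z ^ (\<Sum>i\<leftarrow>[0..<k]. length (\<alpha> ! i))"
    by (rule prod_list_power)
  also have "map (\<lambda>i. length (\<alpha> ! i)) [0..<k] = map length \<alpha>"
    using \<alpha> by (auto intro!: nth_equalityI simp: multiwords_def)
  finally show ?thesis .
qed

lemma tuple_of_ops_scale: "tuple_of_ops k n X \<Longrightarrow> tuple_of_ops k n (scale_tuple H z X)"
  by (auto simp: tuple_of_ops_def scale_tuple_def)

text \<open>The multi-degree \<open>q\<close> enters the dilation behaviour only through its total degree, which makes the
  series along \<open>z X\<close> a power series in \<open>z\<close>.\<close>

lemma ip_homogeneous_part_scale_tuple:
  assumes X: "tuple_of_ops k n X" and xy: "x \<in> V" "y \<in> V"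
  shows "ip (homogeneous_part H k n a (scale_tuple H z X) q x) y
    = z ^ sum_list q * ip (homogeneous_part H k n a X q x) y"
  unfolding ip_homogeneous_part[OF X xy] ip_homogeneous_part[OF tuple_of_ops_scale[OF X] xy] sum_distrib_left
  using xy bop_in[OF monomial_bop[OF X]]
  by (intro sum.cong) (auto simp: monomial_scale_tuple[OF X] op_scale_apply ip_lin)

lemma homogeneous_part_cong:
  assumes X: "tuple_of_ops k n X" and eq: "\<And>i j. i < k \<Longrightarrow> j < n i \<Longrightarrow> X i j = Y i j"
  shows "homogeneous_part H k n a X = homogeneous_part H k n a Y"
proof -
  have mono: "monomial_op H k X \<alpha> = monomial_op H k Y \<alpha>" if "\<alpha> \<in> multiwords k n" for \<alpha>
  proof -
    have "map (X i) (\<alpha> ! i) = map (Y i) (\<alpha> ! i)" if "i < k" for i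
      using \<open>\<alpha> \<in> multiwords k n\<close> eq that by (intro map_cong) (auto simp: multiwords_def)
    then show ?thesis unfolding monomial_op_def by (intro arg_cong[of _ _ "op_prod H"] map_cong) auto
  qed
  have "op_scale H (a \<alpha>) (monomial_op H k X \<alpha>) x \<in> V" if "\<alpha> \<in> multiwords k n" "x \<in> V" for \<alpha> x
    using bop_in[OF bop_scale[OF monomial_bop[OF X that(1)]] that(2)] .
  then have "homogeneous_part H k n a X q = homogeneous_part H k n a Y q" for q
    unfolding homogeneous_part_def op_sum_def
    using mono by (intro restrict_ext M.finsum_cong') auto
  then show ?thesis by blast
qed

lemma series_value_cong:
  assumes X: "tuple_of_ops k n X" and eq: "\<And>i j. i < k \<Longrightarrow> j < n i \<Longrightarrow> X i j = Y i j"
  shows "series_value H k n a X = series_value H k n a Y"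
  unfolding series_value_def series_has_value_def using homogeneous_part_cong[OF X eq] by simp

section \<open>Weak convergence\<close>

text \<open>Norm convergence implies convergence of all matrix coefficients.  Through
  them the values of a formal series become sums of complex numbers, to which complex analysis applies.\<close>

lemma op_has_sum_weak:
  assumes sum: "op_has_sum H f A T" and f: "\<And>q. q \<in> A \<Longrightarrow> f q \<in> bounded_ops H"
    and xy: "x \<in> V" "y \<in> V"
  shows "((\<lambda>q. ip (f q x) y) has_sum ip (T x) y) A"
proof -
  have T: "T \<in> bounded_ops H" and
    lim: "((\<lambda>B. op_norm H (op_diff H (op_sum H f B) T)) \<longlongrightarrow> 0) (finite_subsets_at_top A)"
    using sum by (auto simp: op_has_sum_def)
  have "((\<lambda>B. (\<Sum>q\<in>B. ip (f q x) y) - ip (T x) y) \<longlongrightarrow> 0) (finite_subsets_at_top A)"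
  proof (rule Lim_null_comparison)
    show "\<forall>\<^sub>F B in finite_subsets_at_top A. norm ((\<Sum>q\<in>B. ip (f q x) y) - ip (T x) y)
        \<le> op_norm H (op_diff H (op_sum H f B) T) * nrm x * nrm y"
    proof (rule eventually_finite_subsets_at_top_weakI)
      fix B assume B: "finite B" "B \<subseteq> A"
      have S: "op_sum H f B \<in> bounded_ops H" using f B by (intro bop_sum) auto
      have "ip (op_diff H (op_sum H f B) T x) y = ip (op_sum H f B x) y - ip (T x) y"
        using xy bop_in[OF T] bop_in[OF S] by (simp add: op_diff_apply ip_lin)
      also have "ip (op_sum H f B x) y = (\<Sum>q\<in>B. ip (f q x) y)"
        using xy B bop_in[OF f] by (intro ip_op_sum) auto
      finally have "(\<Sum>q\<in>B. ip (f q x) y) - ip (T x) y = ip (op_diff H (op_sum H f B) T x) y" by simp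
      then show "norm ((\<Sum>q\<in>B. ip (f q x) y) - ip (T x) y)
          \<le> op_norm H (op_diff H (op_sum H f B) T) * nrm x * nrm y"
        using ip_le_op_norm[OF bop_diff[OF S T] xy] by simp
    qed
    show "((\<lambda>B. op_norm H (op_diff H (op_sum H f B) T) * nrm x * nrm y) \<longlongrightarrow> 0) (finite_subsets_at_top A)"
      using tendsto_mult_right[OF tendsto_mult_right[OF lim, of "nrm x"], of "nrm y"] by simp
  qed
  then show ?thesis unfolding has_sum_def by (simp add: LIM_zero_iff)
qed

lemma op_has_sum_unique:
  assumes "op_has_sum H f A S" "op_has_sum H f A T" and f: "\<And>q. q \<in> A \<Longrightarrow> f q \<in> bounded_ops H"
  shows "S = T"
proof (rule bop_eqI)
  fix x y assume xy: "x \<in> V" "y \<in> V"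
  show "ip (S x) y = ip (T x) y"
    using op_has_sum_weak[OF assms(1) f xy] op_has_sum_weak[OF assms(2) f xy] by (rule has_sum_unique)
qed (use assms in \<open>auto simp: op_has_sum_def\<close>)

lemma series_value_eqI:
  assumes "tuple_of_ops k n X" "series_has_value H k n a X T"
  shows "series_value H k n a X = T"
  unfolding series_value_def
  using assms op_has_sum_unique[OF _ _ homogeneous_part_bop[OF assms(1)]]
  by (intro the_equality) (auto simp: series_has_value_def)

lemma series_weak:
  assumes X: "tuple_of_ops k n X" and T: "\<exists>T. series_has_value H k n a X T" and xy: "x \<in> V" "y \<in> V"
  shows "((\<lambda>q. ip (homogeneous_part H k n a X q x) y) has_sum ip (series_value H k n a X x) y)
      {q. length q = k}"
    and "series_value H k n a X \<in> bounded_ops H"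
proof -
  obtain T where T: "series_has_value H k n a X T" using T by blast
  then have v: "series_value H k n a X = T" by (rule series_value_eqI[OF X])
  show "((\<lambda>q. ip (homogeneous_part H k n a X q x) y) has_sum ip (series_value H k n a X x) y)
      {q. length q = k}"
    using T xy homogeneous_part_bop[OF X] unfolding v series_has_value_def by (intro op_has_sum_weak) auto
  show "series_value H k n a X \<in> bounded_ops H"
    using T unfolding v series_has_value_def op_has_sum_def by blast
qed

end

section \<open>Schwarz estimates on the polyball\<close>

lemma finite_lists_of_sum: "finite {q :: nat list. length q = k \<and> sum_list q = m}"
proof (rule finite_subset)
  show "{q. length q = k \<and> sum_list q = m} \<subseteq> {q. set q \<subseteq> {..m} \<and> length q = k}"
    using member_le_sum_list by fastforce
qed (auto intro: finite_lists_length_eq)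

lemma has_sum_finite_sum:
  fixes f :: "'s \<Rightarrow> 'q \<Rightarrow> 'b :: topological_comm_monoid_add"
  assumes "finite I" "\<And>s. s \<in> I \<Longrightarrow> (f s has_sum g s) A"
  shows "((\<lambda>q. \<Sum>s\<in>I. f s q) has_sum (\<Sum>s\<in>I. g s)) A"
  using assms by (induction I) (auto intro: has_sum_add)

context complex_hilbert_space
begin

lemma polyball_ops: "X \<in> polyball H k n \<Longrightarrow> tuple_of_ops k n X"
  using commuting_tuples_bop[OF polyball_commuting] by (auto simp: tuple_of_ops_def)

text \<open>Cauchy--Schwarz for \<open>\<Sum>\<^sub>i \<langle>y\<^sub>i, f\<^sub>i\<^sup>* x\<rangle>\<close>, where the vectors \<open>f\<^sub>i\<^sup>* x\<close> have square sum at most \<open>\<parallel>x\<parallel>\<^sup>2\<close>.\<close>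

lemma row_pairing_bound:
  assumes A: "finite A" and f: "\<And>i. i \<in> A \<Longrightarrow> f i \<in> bounded_ops H"
    and y: "\<And>i. i \<in> A \<Longrightarrow> y i \<in> V" and x: "x \<in> V"
    and le: "row_norm H f A \<le> 1"
  shows "cmod (\<Sum>i\<in>A. ip (f i (y i)) x) \<le> sqrt (\<Sum>i\<in>A. nsq (y i)) * nrm x"
proof -
  have "(\<Sum>i\<in>A. nsq (adj H (f i) x)) \<le> op_norm H (op_sum H (\<lambda>i. op_mult H (f i) (adj H (f i))) A) * nsq x"
    using A f x by (rule row_op_norm_ge)
  also have "\<dots> \<le> 1 * nsq x" using le by (intro mult_right_mono) (auto simp: row_norm_def)
  finally have "sqrt (\<Sum>i\<in>A. nsq (adj H (f i) x)) \<le> nrm x" using x by (simp add: real_le_lsqrt)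
  moreover have "cmod (\<Sum>i\<in>A. ip (f i (y i)) x) \<le> (\<Sum>i\<in>A. \<bar>nrm (y i)\<bar> * \<bar>nrm (adj H (f i) x)\<bar>)"
  proof (intro order_trans[OF norm_sum] sum_mono)
    fix i assume i: "i \<in> A"
    have "cmod (ip (f i (y i)) x) \<le> nrm (y i) * nrm (adj H (f i) x)"
      using adj_eq[OF f[OF i] x y[OF i]] ip_cauchy_schwarz[OF y[OF i] adj_in[OF f[OF i] x]] by simp
    then show "cmod (ip (f i (y i)) x) \<le> \<bar>nrm (y i)\<bar> * \<bar>nrm (adj H (f i) x)\<bar>"
      by (simp flip: abs_mult)
  qed
  moreover have "(\<Sum>i\<in>A. \<bar>nrm (y i)\<bar> * \<bar>nrm (adj H (f i) x)\<bar>)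
      \<le> sqrt (\<Sum>i\<in>A. nsq (y i)) * sqrt (\<Sum>i\<in>A. nsq (adj H (f i) x))"
    using L2_set_mult_ineq[of "\<lambda>i. nrm (y i)" "\<lambda>i. nrm (adj H (f i) x)" A] by (simp add: L2_set_def)
  moreover have "sqrt (\<Sum>i\<in>A. nsq (y i)) * sqrt (\<Sum>i\<in>A. nsq (adj H (f i) x))
      \<le> sqrt (\<Sum>i\<in>A. nsq (y i)) * nrm x"
    using calculation(1) by (intro mult_left_mono) (auto intro: sum_nonneg)
  ultimately show ?thesis by linarith
qed

lemma row_norm_le_sup_norm:
  assumes "sup_norm TYPE('a) k n p F \<le> 1" and X: "X \<in> polyball H k n"
  shows "row_norm H (\<lambda>s. series_value H k n (F s) X) {..<p} \<le> 1"
proof -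
  have "ennreal (row_norm H (\<lambda>s. series_value H k n (F s) X) {..<p}) \<le> sup_norm TYPE('a) k n p F"
    unfolding sup_norm_def using X complex_hilbert_space_axioms
    by (intro SUP_upper2[of "(H, X)"]) auto
  then show ?thesis using assms(1) by (metis ennreal_le_1 order_trans)
qed

text \<open>The Schwarz lemma on the disc \<open>{z X. |z| < 1}\<close>.  The vectors \<open>y s\<close> do not depend on \<open>z\<close>, so that the
  function to which the scalar lemma applies is holomorphic; only afterwards are they chosen in terms
  of the value at one point.\<close>

lemma schwarz_at_tuple:
  assumes hol: "\<And>s. s < p \<Longrightarrow> free_holomorphic TYPE('a) k n (F s)"
    and sup: "sup_norm TYPE('a) k n p F \<le> 1"
    and zero: "\<And>s. s < p \<Longrightarrow> series_value H k n (F s) (zero_tuple H) = op_zero H"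
    and X: "X \<in> polyball H k n" and y: "\<And>s. s < p \<Longrightarrow> y s \<in> V" and x: "x \<in> V"
  defines "B \<equiv> sqrt (\<Sum>s<p. nsq (y s)) * nrm x"
  shows "cmod z < 1 \<Longrightarrow>
      cmod (\<Sum>s<p. ip (series_value H k n (F s) (scale_tuple H z X) (y s)) x) \<le> B * cmod z"
    and "cmod (\<Sum>q | length q = k \<and> sum_list q = 1.
      \<Sum>s<p. ip (homogeneous_part H k n (F s) X q (y s)) x) \<le> B"
proof -
  define \<phi> where "\<phi> z = (\<Sum>s<p. ip (series_value H k n (F s) (scale_tuple H z X) (y s)) x)" for z
  define c where "c q = (\<Sum>s<p. ip (homogeneous_part H k n (F s) X q (y s)) x)" for q
  have ops: "tuple_of_ops k n X" by (rule polyball_ops[OF X])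
  have in_ball: "scale_tuple H z X \<in> polyball H k n" if "cmod z < 1" for z
    using polyball_balanced[OF X] that by simp
  have ex: "\<exists>T. series_has_value H k n (F s) (scale_tuple H z X) T" if "cmod z < 1" "s < p" for z s
    using hol[OF that(2)] in_ball[OF that(1)] complex_hilbert_space_axioms
    unfolding free_holomorphic_def by blast
  have fin: "finite {q \<in> {q :: nat list. length q = k}. sum_list q = m}" for m
    using finite_lists_of_sum[of k m] by simp
  have sum: "((\<lambda>q. z ^ sum_list q * c q) has_sum \<phi> z) {q. length q = k}" if z: "cmod z < 1" for z
  proof -
    have "((\<lambda>q. z ^ sum_list q * ip (homogeneous_part H k n (F s) X q (y s)) x) has_sum
        ip (series_value H k n (F s) (scale_tuple H z X) (y s)) x) {q. length q = k}" if s: "s < p" for s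
      using series_weak(1)[OF tuple_of_ops_scale[OF ops] ex[OF z s] y[OF s] x]
      by (simp add: ip_homogeneous_part_scale_tuple[OF ops y[OF s] x])
    then have "((\<lambda>q. \<Sum>s<p. z ^ sum_list q * ip (homogeneous_part H k n (F s) X q (y s)) x) has_sum \<phi> z)
        {q. length q = k}"
      unfolding \<phi>_def by (intro has_sum_finite_sum) auto
    then show ?thesis by (simp add: c_def sum_distrib_left)
  qed
  have bound: "cmod (\<phi> z) \<le> B" if z: "cmod z < 1" for z
    unfolding \<phi>_def B_def using y x ex[OF z]
    by (intro row_pairing_bound row_norm_le_sup_norm[OF sup in_ball[OF z]]
        series_weak(2)[OF tuple_of_ops_scale[OF ops]]) auto
  have "series_value H k n (F s) (scale_tuple H 0 X) = op_zero H" if s: "s < p" for s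
  proof -
    have "scale_tuple H 0 X i j = zero_tuple H i j" if "i < k" "j < n i" for i j
    proof -
      have "X i j \<in> bounded_ops H" using ops that by (simp add: tuple_of_ops_def)
      then show ?thesis
        using bop_in[of "X i j"] smult_l_null
        by (auto simp: scale_tuple_def zero_tuple_def op_scale_def op_zero_def fun_eq_iff)
    qed
    then show ?thesis
      using series_value_cong[OF tuple_of_ops_scale[OF ops]] zero[OF s] by metis
  qed
  then have "\<phi> 0 = 0" unfolding \<phi>_def using y x by (intro sum.neutral) (auto simp: op_zero_def)
  note schwarz = graded_schwarz[OF fin sum bound this]
  show "cmod z < 1 \<Longrightarrow>
      cmod (\<Sum>s<p. ip (series_value H k n (F s) (scale_tuple H z X) (y s)) x) \<le> B * cmod z"
    using schwarz(1) unfolding \<phi>_def .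
  show "cmod (\<Sum>q | length q = k \<and> sum_list q = 1.
      \<Sum>s<p. ip (homogeneous_part H k n (F s) X q (y s)) x) \<le> B"
    using schwarz(2) unfolding c_def by simp
qed

lemma minkowski_ge:
  assumes X: "X \<in> polyball H k n"
    and le: "\<And>r Y. 0 < r \<Longrightarrow> Y \<in> polyball H k n \<Longrightarrow>
      (\<And>i j. i < k \<Longrightarrow> j < n i \<Longrightarrow> X i j = scale_tuple H (of_real r) Y i j) \<Longrightarrow> a \<le> r"
  shows "a \<le> minkowski H k n X"
  unfolding minkowski_def
proof (rule cInf_greatest)
  have "X i j = op_scale H (complex_of_real 1) (X i j)" if "i < k" "j < n i" for i j
    using commuting_tuples_bop[OF polyball_commuting[OF X] that] by (simp add: op_scale_one)
  then show "{r. 0 < r \<and> (\<exists>Y\<in>polyball H k n. \<forall>i<k. \<forall>j<n i.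
      X i j = op_scale H (complex_of_real r) (Y i j))} \<noteq> {}"
    using X zero_less_one by blast
qed (auto intro: le simp: scale_tuple_def)

text \<open>With \<open>X = r Y\<close> and \<open>y s = F\<^sub>s(X)\<^sup>* x\<close> the function of \<open>schwarz_at_tuple\<close> takes the value
  \<open>S = \<Sum>\<^sub>s \<parallel>F\<^sub>s(X)\<^sup>* x\<parallel>\<^sup>2\<close> at \<open>z = r\<close>, and \<open>S \<le> r \<surd>S \<parallel>x\<parallel>\<close> means \<open>S \<le> r\<^sup>2 \<parallel>x\<parallel>\<^sup>2\<close>.  For \<open>r \<ge> 1\<close> the
  assumption on the sup norm suffices.\<close>

lemma schwarz_minkowski:
  assumes hol: "\<And>s. s < p \<Longrightarrow> free_holomorphic TYPE('a) k n (F s)"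
    and sup: "sup_norm TYPE('a) k n p F \<le> 1"
    and zero: "\<And>s. s < p \<Longrightarrow> series_value H k n (F s) (zero_tuple H) = op_zero H"
    and X: "X \<in> polyball H k n"
  shows "row_norm H (\<lambda>s. series_value H k n (F s) X) {..<p} \<le> minkowski H k n X"
proof (rule minkowski_ge[OF X])
  fix r Y assume r: "0 < r" and Y: "Y \<in> polyball H k n"
    and XY: "\<And>i j. i < k \<Longrightarrow> j < n i \<Longrightarrow> X i j = scale_tuple H (of_real r) Y i j"
  let ?F = "\<lambda>s. series_value H k n (F s) X"
  show "row_norm H ?F {..<p} \<le> r"
  proof (cases "r < 1")
    case False
    then show ?thesis using row_norm_le_sup_norm[OF sup X] by linarith
  next
    case True
    have ops: "tuple_of_ops k n X" by (rule polyball_ops[OF X])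
    have F: "?F s \<in> bounded_ops H" if "s < p" for s
      using series_weak(2)[OF ops] hol[OF that] X complex_hilbert_space_axioms M.zero_closed
      unfolding free_holomorphic_def by blast
    have F_eq: "?F s = series_value H k n (F s) (scale_tuple H (of_real r) Y)" for s
      using series_value_cong[OF ops XY] by blast
    have "(\<Sum>s<p. nsq (adj H (?F s) x)) \<le> r\<^sup>2 * nsq x" if x: "x \<in> V" for x
    proof -
      define S where "S = (\<Sum>s<p. nsq (adj H (?F s) x))"
      have S0: "S \<ge> 0" by (simp add: S_def sum_nonneg)
      have "(\<Sum>s<p. ip (?F s (adj H (?F s) x)) x) = (\<Sum>s<p. of_real (nsq (adj H (?F s) x)))"
        using adj_eq[OF F x] adj_in[OF F x] by (intro sum.cong) (auto simp: ip_self)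
      also have "\<dots> = of_real S" by (simp add: S_def)
      finally have "(\<Sum>s<p. ip (?F s (adj H (?F s) x)) x) = of_real S" .
      then have "S \<le> sqrt S * nrm x * r"
        using schwarz_at_tuple(1)[where y = "\<lambda>s. adj H (?F s) x", OF hol sup zero Y adj_in[OF F x] x,
            of "of_real r"] True r S0
        unfolding F_eq[symmetric] S_def[symmetric] by simp
      then have "sqrt S * sqrt S \<le> (r * nrm x) * sqrt S" using S0 by (simp add: mult_ac)
      then have "sqrt S \<le> r * nrm x"
        using S0 r x mult_right_le_imp_le[of "sqrt S" "sqrt S" "r * nrm x"] by (cases "S = 0") auto
      then have "(sqrt S)\<^sup>2 \<le> (r * nrm x)\<^sup>2" using S0 by (intro power_mono) auto
      then show ?thesis using S0 by (simp add: S_def power_mult_distrib)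
    qed
    then have "op_norm H (op_sum H (\<lambda>s. op_mult H (?F s) (adj H (?F s))) {..<p}) \<le> r\<^sup>2"
      using F by (intro row_op_norm_le) auto
    then show ?thesis using r by (simp add: row_norm_def real_le_lsqrt)
  qed
qed

end

section \<open>The linear part\<close>

definition single_letter :: "nat \<Rightarrow> nat \<Rightarrow> nat \<Rightarrow> nat list list" where
  "single_letter k i j = (replicate k [])[i := [j]]"

lemma Nil_in_word_deriv: "[] \<in> set (word_deriv j w) \<longleftrightarrow> w = [j]"
  by (cases w) auto

lemma replicate_eq_update_iff:
  assumes "length \<alpha> = k" "i < k"
  shows "replicate k [] = \<alpha>[i := w] \<longleftrightarrow> w = [] \<and> (\<forall>l<k. l \<noteq> i \<longrightarrow> \<alpha> ! l = [])"
proof -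
  have "replicate k [] = \<alpha>[i := w] \<longleftrightarrow> (\<forall>l<k. [] = \<alpha>[i := w] ! l)"
    using assms by (subst list_eq_iff_nth_eq) simp
  also have "\<dots> \<longleftrightarrow> (\<forall>l<k. [] = (if l = i then w else \<alpha> ! l))"
    using assms by (auto simp: nth_list_update)
  also have "\<dots> \<longleftrightarrow> w = [] \<and> (\<forall>l<k. l \<noteq> i \<longrightarrow> \<alpha> ! l = [])"
    using assms by metis
  finally show ?thesis .
qed

lemma single_letter_nth: "l < k \<Longrightarrow> single_letter k i j ! l = (if l = i then [j] else [])"
  by (simp add: single_letter_def nth_list_update)

lemma length_single_letter [simp]: "length (single_letter k i j) = k"
  by (simp add: single_letter_def)

lemma single_letter_in_multiwords: "i < k \<Longrightarrow> j < n i \<Longrightarrow> single_letter k i j \<in> multiwords k n"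
  by (auto simp: multiwords_def single_letter_nth)

lemma replicate_in_monomial_deriv:
  assumes "length \<alpha> = k" "i < k"
  shows "replicate k [] \<in> set (monomial_deriv i j \<alpha>) \<longleftrightarrow> \<alpha> = single_letter k i j"
proof -
  have "replicate k [] \<in> set (monomial_deriv i j \<alpha>)
      \<longleftrightarrow> (\<exists>w\<in>set (word_deriv j (\<alpha> ! i)). replicate k [] = \<alpha>[i := w])"
    by (simp add: monomial_deriv_def image_iff)
  also have "\<dots> \<longleftrightarrow> \<alpha> ! i = [j] \<and> (\<forall>l<k. l \<noteq> i \<longrightarrow> \<alpha> ! l = [])"
    unfolding replicate_eq_update_iff[OF assms] Nil_in_word_deriv[symmetric] by blast
  also have "\<dots> \<longleftrightarrow> (\<forall>l<k. \<alpha> ! l = (if l = i then [j] else []))"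
    using assms by metis
  also have "\<dots> \<longleftrightarrow> \<alpha> = single_letter k i j"
    using assms by (subst list_eq_iff_nth_eq) (simp add: single_letter_nth)
  finally show ?thesis .
qed

text \<open>Deleting one letter \<open>j\<close> from the \<open>i\<close>-th word leaves the empty multiword only for the indeterminate
  itself, and in exactly one way.\<close>

lemma const_coeff_free_deriv:
  assumes i: "i < k" and j: "j < n i"
  shows "const_coeff k (free_deriv k n i j a) = a (single_letter k i j)"
proof -
  have "{\<alpha>. \<alpha> \<in> multiwords k n \<and> replicate k [] \<in> set (monomial_deriv i j \<alpha>)} = {single_letter k i j}"
    using replicate_in_monomial_deriv[OF _ i, of _ j] single_letter_in_multiwords[OF i, of j n] j
    by (auto simp: multiwords_def)
  moreover have "monomial_deriv i j (single_letter k i j) = [replicate k []]"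
    using i by (simp add: monomial_deriv_def single_letter_nth) (simp add: single_letter_def list_update_same_conv)
  ultimately show ?thesis by (simp add: const_coeff_def free_deriv_def)
qed

lemma single_letter_inj:
  assumes "i < k" "i' < k"
  shows "single_letter k i j = single_letter k i' j' \<longleftrightarrow> i = i' \<and> j = j'"
proof
  assume eq: "single_letter k i j = single_letter k i' j'"
  have "[j] = single_letter k i j ! i" using assms by (simp add: single_letter_nth)
  also have "\<dots> = (if i = i' then [j'] else [])" unfolding eq using assms by (simp add: single_letter_nth)
  finally show "i = i' \<and> j = j'" by (simp split: if_splits)
qed simp

text \<open>The multiwords of total length 1 are the indeterminates; this identifies the part of degree 1 of a
  formal series with the sum over its free partial derivatives at 0.\<close>

lemma bij_betw_single_letter:
  "bij_betw (\<lambda>(i, j). single_letter k i j) (SIGMA i:{..<k}. {..<n i})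
     {\<alpha> \<in> multiwords k n. sum_list (map length \<alpha>) = 1}"
proof (rule bij_betw_imageI)
  show "inj_on (\<lambda>(i, j). single_letter k i j) (SIGMA i:{..<k}. {..<n i})"
    by (auto simp: inj_on_def single_letter_inj)
  have total: "sum_list (map length \<alpha>) = (\<Sum>l<k. length (\<alpha> ! l))" if "length \<alpha> = k" for \<alpha> :: "nat list list"
    using that by (simp add: sum_list_sum_nth atLeast0LessThan)
  show "(\<lambda>(i, j). single_letter k i j) ` (SIGMA i:{..<k}. {..<n i})
      = {\<alpha> \<in> multiwords k n. sum_list (map length \<alpha>) = 1}"
  proof (intro equalityI subsetI)
    fix \<alpha> assume "\<alpha> \<in> (\<lambda>(i, j). single_letter k i j) ` (SIGMA i:{..<k}. {..<n i})"
    then obtain i j where ij: "i < k" "j < n i" "\<alpha> = single_letter k i j" by auto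
    have "(\<Sum>l<k. length (single_letter k i j ! l)) = (\<Sum>l<k. if l = i then 1 else 0)"
      by (intro sum.cong) (auto simp: single_letter_nth)
    then show "\<alpha> \<in> {\<alpha> \<in> multiwords k n. sum_list (map length \<alpha>) = 1}"
      using ij single_letter_in_multiwords[of i k j n] total[of \<alpha>] by simp
  next
    fix \<alpha> assume "\<alpha> \<in> {\<alpha> \<in> multiwords k n. sum_list (map length \<alpha>) = 1}"
    then have \<alpha>: "\<alpha> \<in> multiwords k n" "length \<alpha> = k" "(\<Sum>l<k. length (\<alpha> ! l)) = 1"
      using total[of \<alpha>] by (auto simp: multiwords_def)
    then obtain i where i: "i < k" "length (\<alpha> ! i) = 1" "\<And>l. l < k \<Longrightarrow> l \<noteq> i \<Longrightarrow> \<alpha> ! l = []"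
      using sum_eq_1_iff[of "{..<k}" "\<lambda>l. length (\<alpha> ! l)"] by fastforce
    then obtain j where j: "\<alpha> ! i = [j]" by (auto simp: length_Suc_conv)
    have "set (\<alpha> ! i) \<subseteq> {..<n i}" using \<alpha>(1) i(1) by (simp add: multiwords_def)
    then have "j < n i" using j by simp
    moreover have "\<alpha> = single_letter k i j"
      using \<alpha>(2) i j by (intro nth_equalityI) (auto simp: single_letter_nth)
    ultimately show "\<alpha> \<in> (\<lambda>(i, j). single_letter k i j) ` (SIGMA i:{..<k}. {..<n i})"
      using i(1) by auto
  qed
qed

lemma linear_part_eq:
  assumes \<alpha>: "\<alpha> \<in> multiwords k n"
  shows "linear_part k n a \<alpha> = (if sum_list (map length \<alpha>) = 1 then a \<alpha> else 0)"
proof -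
  let ?I = "SIGMA i:{..<k}. {..<n i}"
  have "linear_part k n a \<alpha> = (\<Sum>(i, j)\<in>?I. const_coeff k (free_deriv k n i j a) * indeterminate k i j \<alpha>)"
    by (simp add: linear_part_def sum.Sigma)
  also have "\<dots> = (\<Sum>(i, j)\<in>?I. if single_letter k i j = \<alpha> then a \<alpha> else 0)"
    by (intro sum.cong) (auto simp: const_coeff_free_deriv indeterminate_def single_letter_def[symmetric])
  also have "\<dots> = (\<Sum>\<beta> | \<beta> \<in> multiwords k n \<and> sum_list (map length \<beta>) = 1. if \<beta> = \<alpha> then a \<alpha> else 0)"
    using sum.reindex_bij_betw[OF bij_betw_single_letter, of "\<lambda>\<beta>. if \<beta> = \<alpha> then a \<alpha> else 0" k n]
    by (simp add: case_prod_unfold)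
  also have "\<dots> = (if sum_list (map length \<alpha>) = 1 then a \<alpha> else 0)"
  proof -
    have "finite {\<beta>. \<beta> \<in> multiwords k n \<and> sum_list (map length \<beta>) = 1}"
      using bij_betw_finite[OF bij_betw_single_letter[of k n]] by simp
    then show ?thesis using \<alpha> by simp
  qed
  finally show ?thesis .
qed

context complex_hilbert_space
begin

definition linear_value :: "nat \<Rightarrow> (nat \<Rightarrow> nat) \<Rightarrow> formal_series \<Rightarrow> 'a op_tuple \<Rightarrow> 'a \<Rightarrow> 'a" where
  "linear_value k n a X =
     op_sum H (\<lambda>(i, j). op_scale H (const_coeff k (free_deriv k n i j a)) (X i j))
       (SIGMA i:{..<k}. {..<n i})"

lemma linear_value_bop:
  assumes "tuple_of_ops k n X"
  shows "linear_value k n a X \<in> bounded_ops H"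
  unfolding linear_value_def using assms by (intro bop_sum) (auto simp: tuple_of_ops_def)

lemma ip_linear_value:
  assumes X: "tuple_of_ops k n X" and xy: "x \<in> V" "y \<in> V"
  shows "ip (linear_value k n a X x) y
    = (\<Sum>(i, j)\<in>(SIGMA i:{..<k}. {..<n i}). a (single_letter k i j) * ip (X i j x) y)"
proof -
  have X': "X i j x \<in> V" if "i < k" "j < n i" for i j
    using X xy that bop_in by (auto simp: tuple_of_ops_def)
  show ?thesis
    unfolding linear_value_def using xy X'
    by (subst ip_op_sum) (auto simp: op_scale_apply ip_lin const_coeff_free_deriv intro!: sum.cong)
qed

lemma monomial_single_letter:
  assumes X: "tuple_of_ops k n X" and ij: "i < k" "j < n i"
  shows "monomial_op H k X (single_letter k i j) = X i j"
proof -
  have Xij: "X i j \<in> bounded_ops H" using X ij by (simp add: tuple_of_ops_def)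
  have id_right: "op_mult H T (op_id H) = T" and id_left: "op_mult H (op_id H) T = T"
    if "T \<in> bounded_ops H" for T
    using that by (auto intro!: bop_eqI simp: op_mult_apply op_id_apply bop_in)
  have "op_prod H (map (\<lambda>l. op_prod H (map (X l) (single_letter k i j ! l))) L)
      = (if i \<in> set L then X i j else op_id H)" if "set L \<subseteq> {..<k}" "distinct L" for L
    using that
  proof (induction L)
    case (Cons l L)
    then show ?case
      using Xij by (auto simp: op_prod_def single_letter_nth id_left id_right)
  qed (simp add: op_prod_def)
  from this[of "[0..<k]"] show ?thesis
    unfolding monomial_op_def using ij by (auto simp: atLeast0LessThan)
qed

lemma sum_linear_homogeneous_parts:
  assumes X: "tuple_of_ops k n X" and xy: "x \<in> V" "y \<in> V"
  shows "(\<Sum>q | length q = k \<and> sum_list q = 1. ip (homogeneous_part H k n a X q x) y)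
    = ip (linear_value k n a X x) y"
proof -
  let ?W = "{\<alpha> \<in> multiwords k n. sum_list (map length \<alpha>) = 1}"
  have finW: "finite ?W" using bij_betw_finite[OF bij_betw_single_letter[of k n]] by simp
  have "(\<Sum>q | length q = k \<and> sum_list q = 1. ip (homogeneous_part H k n a X q x) y)
    = (\<Sum>q | length q = k \<and> sum_list q = 1.
        \<Sum>\<alpha> | \<alpha> \<in> ?W \<and> map length \<alpha> = q. a \<alpha> * ip (monomial_op H k X \<alpha> x) y)"
    unfolding ip_homogeneous_part[OF X xy] by (intro sum.cong) auto
  also have "\<dots> = (\<Sum>\<alpha>\<in>?W. a \<alpha> * ip (monomial_op H k X \<alpha> x) y)"
    using finW finite_lists_of_sum by (intro sum.group) (auto simp: multiwords_def)
  also have "\<dots> = (\<Sum>p\<in>(SIGMA i:{..<k}. {..<n i}).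
      a (case p of (i, j) \<Rightarrow> single_letter k i j) * ip (monomial_op H k X (case p of (i, j) \<Rightarrow> single_letter k i j) x) y)"
    by (rule sum.reindex_bij_betw[OF bij_betw_single_letter, symmetric])
  also have "\<dots> = ip (linear_value k n a X x) y"
    unfolding ip_linear_value[OF X xy] using monomial_single_letter[OF X] by (intro sum.cong) auto
  finally show ?thesis .
qed

text \<open>All homogeneous parts of total degree different from 1 vanish, so the net of partial sums is
  eventually constant.\<close>

lemma linear_part_has_value:
  assumes X: "tuple_of_ops k n X"
  shows "series_has_value H k n (linear_part k n a) X (linear_value k n a X)"
  unfolding series_has_value_def op_has_sum_def
proof
  let ?h = "homogeneous_part H k n (linear_part k n a) X"
  let ?Q = "{q :: nat list. length q = k \<and> sum_list q = 1}"
  show "linear_value k n a X \<in> bounded_ops H" by (rule linear_value_bop[OF X])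
  have "op_norm H (op_diff H (op_sum H ?h B) (linear_value k n a X)) = 0"
    if B: "finite B" "?Q \<subseteq> B" "B \<subseteq> {q. length q = k}" for B
  proof -
    have part: "ip (?h q x) y = (if sum_list q = 1 then ip (homogeneous_part H k n a X q x) y else 0)"
      if "x \<in> V" "y \<in> V" for q x y
      unfolding ip_homogeneous_part[OF X that] by (auto simp: linear_part_eq intro!: sum.cong sum.neutral)
    have S: "op_sum H ?h B \<in> bounded_ops H" using homogeneous_part_bop[OF X] B by (intro bop_sum) auto
    have "op_sum H ?h B = linear_value k n a X"
    proof (rule bop_eqI[OF S linear_value_bop[OF X]])
      fix x y assume xy: "x \<in> V" "y \<in> V"
      have "ip (op_sum H ?h B x) y = (\<Sum>q\<in>B. ip (?h q x) y)"
        using bop_in[OF homogeneous_part_bop[OF X]] B xy by (intro ip_op_sum) auto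
      also have "\<dots> = (\<Sum>q\<in>?Q. ip (homogeneous_part H k n a X q x) y)"
        unfolding part[OF xy] using B by (subst sum.inter_filter[symmetric]) (auto intro!: sum.cong)
      also have "\<dots> = ip (linear_value k n a X x) y" by (rule sum_linear_homogeneous_parts[OF X xy])
      finally show "ip (op_sum H ?h B x) y = ip (linear_value k n a X x) y" .
    qed
    then have "nrm (op_diff H (op_sum H ?h B) (linear_value k n a X) x) = 0" if "x \<in> V" for x
      using bop_in[OF linear_value_bop[OF X] that] that by (simp add: op_diff_apply a_minus_def M.r_neg)
    then have "op_norm H (op_diff H (op_sum H ?h B) (linear_value k n a X)) \<le> 0"
      by (intro op_norm_le) auto
    then show ?thesis using op_norm_nonneg[OF bop_diff[OF S linear_value_bop[OF X, of a]]] by linarith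
  qed
  then have "eventually (\<lambda>B. op_norm H (op_diff H (op_sum H ?h B) (linear_value k n a X)) = 0)
      (finite_subsets_at_top {q. length q = k})"
    unfolding eventually_finite_subsets_at_top
    using finite_lists_of_sum[of k 1] by (intro exI[of _ ?Q]) auto
  then show "((\<lambda>B. op_norm H (op_diff H (op_sum H ?h B) (linear_value k n a X))) \<longlongrightarrow> 0)
      (finite_subsets_at_top {q. length q = k})"
    by (rule tendsto_eventually)
qed

text \<open>The matrix coefficients of the linear value at \<open>Y\<close> are the first Taylor coefficients bounded in
  \<open>schwarz_at_tuple\<close>; for \<open>X = r Y\<close> linearity contributes the factor \<open>r\<close>.\<close>

lemma linear_value_contractive:
  assumes hol: "free_holomorphic TYPE('a) k n (F 0)"
    and sup: "sup_norm TYPE('a) k n 1 F \<le> 1"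
    and zero: "series_value H k n (F 0) (zero_tuple H) = op_zero H"
    and X: "X \<in> polyball H k n"
  shows "op_norm H (linear_value k n (F 0) X) \<le> minkowski H k n X"
proof (rule minkowski_ge[OF X])
  fix r Y assume r: "0 < r" and Y: "Y \<in> polyball H k n"
    and XY: "\<And>i j. i < k \<Longrightarrow> j < n i \<Longrightarrow> X i j = scale_tuple H (of_real r) Y i j"
  note opsY = polyball_ops[OF Y] and opsX = polyball_ops[OF X]
  show "op_norm H (linear_value k n (F 0) X) \<le> r"
  proof (rule op_norm_le)
    fix x assume x: "x \<in> V"
    define w where "w = linear_value k n (F 0) X x"
    have w: "w \<in> V" using bop_in[OF linear_value_bop[OF opsX] x] by (simp add: w_def)
    have "ip w w = of_real r * ip (linear_value k n (F 0) Y x) w"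
    proof -
      have "Y i j x \<in> V" if "i < k" "j < n i" for i j
        using opsY x that bop_in by (auto simp: tuple_of_ops_def)
      then show ?thesis
        unfolding w_def[symmetric] ip_linear_value[OF opsY x w]
        by (subst (1) w_def, unfold ip_linear_value[OF opsX x w] sum_distrib_left)
          (auto intro!: sum.cong simp: XY scale_tuple_def op_scale_apply x ip_lin w)
    qed
    moreover have "cmod (ip (linear_value k n (F 0) Y x) w) \<le> nrm x * nrm w"
    proof -
      have single: "(\<Sum>s<1. g s) = g 0" for g :: "nat \<Rightarrow> 'b :: comm_monoid_add" by simp
      have "cmod (\<Sum>q | length q = k \<and> sum_list q = 1.
          \<Sum>s<1. ip (homogeneous_part H k n (F s) Y q x) w) \<le> sqrt (\<Sum>s<1::nat. nsq x) * nrm w"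
        by (rule schwarz_at_tuple(2)) (use hol sup zero Y x w in auto)
      then show ?thesis
        unfolding single sum_linear_homogeneous_parts[OF opsY x w] using x by simp
    qed
    ultimately have "cmod (ip w w) \<le> r * nrm x * nrm w"
      using r by (simp add: norm_mult mult.assoc)
    then show "nrm (linear_value k n (F 0) X x) \<le> r * nrm x"
      using nrm_le_if_ip_le[OF w, of "r * nrm x"] r x by (simp add: w_def)
  qed (use r in simp)
qed

end

theorem theorem2p7:
  fixes H :: "'a cinner_module"
    and k p :: nat and n :: "nat \<Rightarrow> nat"
    and F :: "nat \<Rightarrow> formal_series"
  assumes "complex_hilbert_space H"
    and "k \<ge> 1" and "\<And>i. i < k \<Longrightarrow> n i \<ge> 1" and "p \<ge> 1"
    and "bounded_free_holomorphic TYPE('a) k n p F"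
    and "sup_norm TYPE('a) k n p F \<le> 1"
    and "\<And>s. s < p \<Longrightarrow> series_value H k n (F s) (zero_tuple H) = op_zero H"
  shows "(\<forall>X\<in>polyball H k n.
            row_norm H (\<lambda>s. series_value H k n (F s) X) {..<p} \<le> minkowski H k n X \<and>
            minkowski H k n X < 1 \<and>
            minkowski H k n X \<le> tuple_norm H k n X) \<and>
         (p = 1 \<longrightarrow>
            free_holomorphic TYPE('a) k n (linear_part k n (F 0)) \<and>
            (\<forall>X\<in>polyball H k n.
               series_value H k n (linear_part k n (F 0)) X =
                 op_sum H (\<lambda>(i, j). op_scale H (const_coeff k (free_deriv k n i j (F 0))) (X i j))
                   (SIGMA i:{..<k}. {..<n i}) \<and>
               op_norm H (series_value H k n (linear_part k n (F 0)) X) \<le> minkowski H k n X \<and>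
               minkowski H k n X < 1))"
proof -
  interpret complex_hilbert_space H by fact
  have hol: "free_holomorphic TYPE('a) k n (F s)" if "s < p" for s
    using assms(5) that by (simp add: bounded_free_holomorphic_def)
  have linear: "series_value H k n (linear_part k n (F 0)) X = linear_value k n (F 0) X"
    if "X \<in> polyball H k n" for X
    using series_value_eqI[OF _ linear_part_has_value] polyball_ops[OF that] by blast
  show ?thesis
  proof (intro conjI ballI impI)
    fix X assume X: "X \<in> polyball H k n"
    show "row_norm H (\<lambda>s. series_value H k n (F s) X) {..<p} \<le> minkowski H k n X"
      using hol assms(6,7) X by (rule schwarz_minkowski)
    show "minkowski H k n X < 1" using X by (rule minkowski_less_1)
    then show "minkowski H k n X < 1" .
    show "minkowski H k n X \<le> tuple_norm H k n X"
      using X by (intro minkowski_le_tuple_norm polyball_commuting)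
    show "series_value H k n (linear_part k n (F 0)) X =
        op_sum H (\<lambda>(i, j). op_scale H (const_coeff k (free_deriv k n i j (F 0))) (X i j))
          (SIGMA i:{..<k}. {..<n i})"
      using linear[OF X] by (simp only: linear_value_def)
    show "op_norm H (series_value H k n (linear_part k n (F 0)) X) \<le> minkowski H k n X" if "p = 1"
      unfolding linear[OF X] using that hol[of 0] assms(6,7) X by (intro linear_value_contractive) auto
  next
    show "free_holomorphic TYPE('a) k n (linear_part k n (F 0))"
      unfolding free_holomorphic_def
      using complex_hilbert_space.linear_part_has_value complex_hilbert_space.polyball_ops by blast
  qed
qed

end
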